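(* The Cantor fan is (homeomorphic to) the spectrum of a sequence in $\mathbf{X}$. Every smooth fan is (homeomorphic to) the spectrum of a sequence in $\mathbf{L}$.
   Context: Topological fans. A continuum is a non-empty compact connected metrizable space. A topological fan is a continuum that is arcwise connected, hereditarily unicoherent (the intersection of any two subcontinua is connected), and has exactly one ramification point, i.e. a point $x$ such that there are three arcs pairwise intersecting exactly in $\{x\}$ and having $x$ as an endpoint. The Cantor fan is the quotient of $C\times[0,1]$, $C$ the Cantor space, obtained by collapsing $C\times\{0\}$ to a point. A smooth fan is a topological fan that is a subspace of the Cantor fan. Graphs. A graph is a finite non-empty set $G$ with a reflexive symmetric relation $\sqcap$ (the edge relation); the degree of $g$ is $|\{g'\ne g:g'\sqcap g\}|$; an end is a vertex of degree at most $1$, and $\mathsf{E}G$ is the set of ends. A subset of a graph is connected if it cannot be split into two non-empty parts with no edge between them (the empty set is connected). A (nontrivial graph) fan is a connected acyclic graph with exactly one vertex of degree $\ge3$, its root $0_F$; its spokes are the subpaths whose ends are the root and an end of $F$; $*F$ is the set of spokes. Relations. A relation $R\subseteq H\times G$ between graphs is viewed as a relation from $G$ to $H$; write $R(g)=\{h:(h,g)\in R\}$, $R^{-1}(h)=\{g:(h,g)\in R\}$, $R(S)=\bigcup_{g\in S}R(g)$; $(c,a)\in Q\circ R$ iff $(c,b)\in Q$ and $(b,a)\in R$ for some $b$. $R$ is: edge-preserving if $(h,g),(h',g')\in R$ and $g\sqcap g'$ imply $h\sqcap h'$; co-bijective if $R(g)\ne\emptyset$ for all $g$ and for all $h\in H$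 there is $g$ with $R(g)=\{h\}$; monotone if $\bigcup_{h\in C}R^{-1}(h)$ is connected for every connected $C\subseteq H$. Between graph fans $G,H$, $R$ is spoke-monotone if $R(0_G)=\{0_H\}$ and for every $S\in *G$ there is $T\in *H$ with $R(S)\subseteq T$ and $R\cap(T\times S)$ monotone (as a relation from $S$ to $T$); end-preserving if $R(e)\subseteq\mathsf{E}H$ for all $e\in\mathsf{E}G$. $\mathbf{L}$ is the category of nontrivial graph fans with co-bijective edge-preserving spoke-monotone relations as morphisms; $\mathbf{X}$ has the same objects and the end-preserving morphisms of $\mathbf{L}$. Sequences and spectra. A sequence in $\mathbf{C}$ is a family $(G_n,R^m_n)_{m\le n\in\omega}$ with $R^m_n$ a morphism of $\mathbf{C}$ from $G_n$ to $G_m$, $R^n_n$ the identity and $R^l_m\circ R^m_n=R^l_n$ for $l\le m\le n$. Its induced poset is the disjoint union $\mathbb{P}=\bigsqcup_nG_n$, where for $p\in G_n$, $q\in G_m$, $p\le q$ iff $m\le n$ and $(q,p)\in R^m_n$. In a poset $\mathbb{P}$, a band is a finite $B\subseteq\mathbb{P}$ such that every element of $\mathbb{P}$ is comparable to an element of $B$; a cap is a set $C\subseteq\mathbb P$ for which there is a band $B$ such that each $b\in B$ is $\le$ some $c\in C$; a selector is a subset of $\mathbb{P}$ meeting every cap. The spectrum $\mathsf{S}\mathbb{P}$ is the set of minimal selectors (with respect to inclusion) with the topology generated by the sets $p^\in=\{S\in\mathsf{S}\mathbb{P}:p\in S\}$, $p\in\mathbb{P}$. The spectrum of a sequence is the spectrum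 of its induced poset. *)

theory Defs
  imports "HOL-Analysis.Analysis"
begin

section \<open>Topological fans\<close>

definition continuum :: "'a topology \<Rightarrow> bool" where
  "continuum X \<longleftrightarrow>
     topspace X \<noteq> {} \<and> compact_space X \<and> connected_space X \<and> metrizable_space X"

definition subcontinuum :: "'a topology \<Rightarrow> 'a set \<Rightarrow> bool" where
  "subcontinuum X A \<longleftrightarrow> A \<subseteq> topspace X \<and> continuum (subtopology X A)"

definition arc_between :: "'a topology \<Rightarrow> 'a \<Rightarrow> 'a \<Rightarrow> 'a set \<Rightarrow> bool" where
  "arc_between X x y A \<longleftrightarrow>
     (\<exists>f. embedding_map (top_of_set {0..1::real}) X f \<and> f 0 = x \<and> f 1 = y \<and> A = f ` {0..1})"

definition arcwise_connected_space :: "'a topology \<Rightarrow> bool" where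
  "arcwise_connected_space X \<longleftrightarrow>
     (\<forall>x\<in>topspace X. \<forall>y\<in>topspace X. x \<noteq> y \<longrightarrow> (\<exists>A. arc_between X x y A))"

definition hereditarily_unicoherent :: "'a topology \<Rightarrow> bool" where
  "hereditarily_unicoherent X \<longleftrightarrow>
     (\<forall>A B. subcontinuum X A \<and> subcontinuum X B \<longrightarrow> connectedin X (A \<inter> B))"

definition ramification_point :: "'a topology \<Rightarrow> 'a \<Rightarrow> bool" where
  "ramification_point X x \<longleftrightarrow>
     (\<exists>A B C a b c. arc_between X x a A \<and> arc_between X x b B \<and> arc_between X x c C \<and>
        A \<inter> B = {x} \<and> A \<inter> C = {x} \<and> B \<inter> C = {x})"

definition topological_fan :: "'a topology \<Rightarrow> bool" where
  "topological_fan X \<longleftrightarrow>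
     continuum X \<and> arcwise_connected_space X \<and> hereditarily_unicoherent X \<and>
     (\<exists>!x. ramification_point X x)"

definition quotient_topology :: "'a topology \<Rightarrow> ('a \<Rightarrow> 'b) \<Rightarrow> 'b topology" where
  "quotient_topology X q =
     topology (\<lambda>U. U \<subseteq> q ` topspace X \<and> openin X {x \<in> topspace X. q x \<in> U})"

lemma openin_quotient_topology:
  "openin (quotient_topology X q) U \<longleftrightarrow>
     U \<subseteq> q ` topspace X \<and> openin X {x \<in> topspace X. q x \<in> U}"
proof -
  have "istopology (\<lambda>U. U \<subseteq> q ` topspace X \<and> openin X {x \<in> topspace X. q x \<in> U})"
    unfolding istopology_def
  proof (intro conjI allI impI)
    fix S T
    assume "S \<subseteq> q ` topspace X \<and> openin X {x \<in> topspace X. q x \<in> S}"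
      and "T \<subseteq> q ` topspace X \<and> openin X {x \<in> topspace X. q x \<in> T}"
    moreover have "{x \<in> topspace X. q x \<in> S \<inter> T} =
        {x \<in> topspace X. q x \<in> S} \<inter> {x \<in> topspace X. q x \<in> T}"
      by auto
    ultimately show "S \<inter> T \<subseteq> q ` topspace X" "openin X {x \<in> topspace X. q x \<in> S \<inter> T}"
      by auto
  next
    fix \<K>
    assume *: "\<forall>K\<in>\<K>. K \<subseteq> q ` topspace X \<and> openin X {x \<in> topspace X. q x \<in> K}"
    have "{x \<in> topspace X. q x \<in> \<Union>\<K>} = (\<Union>K\<in>\<K>. {x \<in> topspace X. q x \<in> K})"
      by auto
    with * show "openin X {x \<in> topspace X. q x \<in> \<Union>\<K>}"
      by auto
    from * show "\<Union>\<K> \<subseteq> q ` topspace X"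
      by auto
  qed
  then show ?thesis
    by (simp add: quotient_topology_def topology_inverse')
qed

lemma topspace_quotient_topology [simp]:
  "topspace (quotient_topology X q) = q ` topspace X"
proof
  show "topspace (quotient_topology X q) \<subseteq> q ` topspace X"
    using openin_quotient_topology openin_topspace by metis
  have "{x \<in> topspace X. q x \<in> q ` topspace X} = topspace X"
    by auto
  then have "openin (quotient_topology X q) (q ` topspace X)"
    by (simp add: openin_quotient_topology)
  then show "q ` topspace X \<subseteq> topspace (quotient_topology X q)"
    by (rule openin_subset)
qed

lemma quotient_map_quotient_topology: "quotient_map X (quotient_topology X q) q"
  by (auto simp: quotient_map_def openin_quotient_topology)

definition cantor_space :: "(nat \<Rightarrow> bool) topology" where
  "cantor_space = product_topology (\<lambda>_. discrete_topology UNIV) UNIV"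

text \<open>The points of the Cantor fan are the equivalence classes of the relation that identifies
  all the points of \<open>C \<times> {0}\<close>.\<close>

definition cantor_fan :: "((nat \<Rightarrow> bool) \<times> real) set topology" where
  "cantor_fan =
     quotient_topology (prod_topology cantor_space (top_of_set {0..1}))
       (\<lambda>z. if snd z = 0 then topspace cantor_space \<times> {0} else {z})"

text \<open>``Subspace of the Cantor fan'' is understood up to homeomorphism.\<close>

definition smooth_fan :: "'a topology \<Rightarrow> bool" where
  "smooth_fan X \<longleftrightarrow> topological_fan X \<and> (\<exists>f. embedding_map X cantor_fan f)"


section \<open>Graphs and graph fans\<close>

record 'a graph =
  verts :: "'a set"
  adj :: "('a \<times> 'a) set"

definition is_graph :: "'a graph \<Rightarrow> bool" where
  "is_graph G \<longleftrightarrow>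
     finite (verts G) \<and> verts G \<noteq> {} \<and>
     adj G \<subseteq> verts G \<times> verts G \<and> refl_on (verts G) (adj G) \<and> sym (adj G)"

definition induced_graph :: "'a graph \<Rightarrow> 'a set \<Rightarrow> 'a graph" where
  "induced_graph G S = \<lparr>verts = S, adj = adj G \<inter> S \<times> S\<rparr>"

definition vertex_degree :: "'a graph \<Rightarrow> 'a \<Rightarrow> nat" where
  "vertex_degree G g = card {g' \<in> verts G. g' \<noteq> g \<and> (g', g) \<in> adj G}"

definition graph_ends :: "'a graph \<Rightarrow> 'a set" where
  "graph_ends G = {g \<in> verts G. vertex_degree G g \<le> 1}"

definition connected_subset :: "'a graph \<Rightarrow> 'a set \<Rightarrow> bool" where
  "connected_subset G S \<longleftrightarrow>
     S \<subseteq> verts G \<and>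
     \<not> (\<exists>A B. A \<noteq> {} \<and> B \<noteq> {} \<and> A \<inter> B = {} \<and> A \<union> B = S \<and> adj G \<inter> A \<times> B = {})"

text \<open>Since adjacency is reflexive, cycles need at least three distinct vertices.\<close>

definition graph_cycle :: "'a graph \<Rightarrow> 'a list \<Rightarrow> bool" where
  "graph_cycle G xs \<longleftrightarrow>
     length xs \<ge> 3 \<and> distinct xs \<and> set xs \<subseteq> verts G \<and>
     successively (\<lambda>x y. (x, y) \<in> adj G) xs \<and> (last xs, hd xs) \<in> adj G"

definition acyclic_graph :: "'a graph \<Rightarrow> bool" where
  "acyclic_graph G \<longleftrightarrow> (\<nexists>xs. graph_cycle G xs)"

definition path_graph :: "'a graph \<Rightarrow> bool" where
  "path_graph G \<longleftrightarrow>
     is_graph G \<and> connected_subset G (verts G) \<and> acyclic_graph G \<and>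
     (\<forall>g\<in>verts G. vertex_degree G g \<le> 2)"

definition graph_fan :: "'a graph \<Rightarrow> bool" where
  "graph_fan F \<longleftrightarrow>
     is_graph F \<and> connected_subset F (verts F) \<and> acyclic_graph F \<and>
     (\<exists>!r. r \<in> verts F \<and> vertex_degree F r \<ge> 3)"

definition fan_root :: "'a graph \<Rightarrow> 'a" where
  "fan_root F = (THE r. r \<in> verts F \<and> vertex_degree F r \<ge> 3)"

text \<open>Paths in an acyclic graph are induced subgraphs, so a spoke is given by its vertex set.\<close>

definition spokes :: "'a graph \<Rightarrow> 'a set set" where
  "spokes F =
     {S. S \<subseteq> verts F \<and> path_graph (induced_graph F S) \<and>
         (\<exists>e\<in>graph_ends F. graph_ends (induced_graph F S) = {fan_root F, e})}"


section \<open>Relations between graphs\<close>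

text \<open>A relation from \<open>G\<close> to \<open>H\<close> is a set \<open>R \<subseteq> H \<times> G\<close>. With respect to this orientation the image
  \<open>R(S)\<close> of \<open>S \<subseteq> G\<close> is \<^term>\<open>R\<inverse> `` S\<close>, the preimage \<open>R\<^sup>-\<^sup>1(C)\<close> of \<open>C \<subseteq> H\<close> is \<^term>\<open>R `` C\<close>, and the
  composition of \<open>Q\<close> after \<open>R\<close> is \<^term>\<open>Q O R\<close>. Below, the source graph is the first argument and
  the target graph the second.\<close>

definition edge_preserving :: "'a graph \<Rightarrow> 'b graph \<Rightarrow> ('b \<times> 'a) set \<Rightarrow> bool" where
  "edge_preserving G H R \<longleftrightarrow>
     (\<forall>h g h' g'. (h, g) \<in> R \<and> (h', g') \<in> R \<and> (g, g') \<in> adj G \<longrightarrow> (h, h') \<in> adj H)"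

definition co_bijective :: "'a graph \<Rightarrow> 'b graph \<Rightarrow> ('b \<times> 'a) set \<Rightarrow> bool" where
  "co_bijective G H R \<longleftrightarrow>
     (\<forall>g\<in>verts G. R\<inverse> `` {g} \<noteq> {}) \<and> (\<forall>h\<in>verts H. \<exists>g\<in>verts G. R\<inverse> `` {g} = {h})"

definition monotone_rel :: "'a graph \<Rightarrow> 'b graph \<Rightarrow> ('b \<times> 'a) set \<Rightarrow> bool" where
  "monotone_rel G H R \<longleftrightarrow> (\<forall>C. connected_subset H C \<longrightarrow> connected_subset G (R `` C))"

definition spoke_monotone :: "'a graph \<Rightarrow> 'b graph \<Rightarrow> ('b \<times> 'a) set \<Rightarrow> bool" where
  "spoke_monotone G H R \<longleftrightarrow>
     R\<inverse> `` {fan_root G} = {fan_root H} \<and>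
     (\<forall>S\<in>spokes G. \<exists>T\<in>spokes H. R\<inverse> `` S \<subseteq> T \<and>
        monotone_rel (induced_graph G S) (induced_graph H T) (R \<inter> T \<times> S))"

definition end_preserving :: "'a graph \<Rightarrow> 'b graph \<Rightarrow> ('b \<times> 'a) set \<Rightarrow> bool" where
  "end_preserving G H R \<longleftrightarrow> (\<forall>e\<in>graph_ends G. R\<inverse> `` {e} \<subseteq> graph_ends H)"

definition L_morphism :: "'a graph \<Rightarrow> 'b graph \<Rightarrow> ('b \<times> 'a) set \<Rightarrow> bool" where
  "L_morphism G H R \<longleftrightarrow>
     graph_fan G \<and> graph_fan H \<and> R \<subseteq> verts H \<times> verts G \<and>
     co_bijective G H R \<and> edge_preserving G H R \<and> spoke_monotone G H R"

definition X_morphism :: "'a graph \<Rightarrow> 'b graph \<Rightarrow> ('b \<times> 'a) set \<Rightarrow> bool" where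
  "X_morphism G H R \<longleftrightarrow> L_morphism G H R \<and> end_preserving G H R"


section \<open>Sequences and their induced posets\<close>

text \<open>\<open>R m n\<close>, for \<open>m \<le> n\<close>, is the bonding morphism from \<open>G n\<close> to \<open>G m\<close>; its values for \<open>m > n\<close> are
  irrelevant.\<close>

definition graph_sequence ::
  "('a graph \<Rightarrow> 'a graph \<Rightarrow> ('a \<times> 'a) set \<Rightarrow> bool) \<Rightarrow>
   (nat \<Rightarrow> 'a graph) \<Rightarrow> (nat \<Rightarrow> nat \<Rightarrow> ('a \<times> 'a) set) \<Rightarrow> bool" where
  "graph_sequence Mor G R \<longleftrightarrow>
     (\<forall>m n. m \<le> n \<longrightarrow> Mor (G n) (G m) (R m n)) \<and>
     (\<forall>n. R n n = Id_on (verts (G n))) \<and>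
     (\<forall>l m n. l \<le> m \<and> m \<le> n \<longrightarrow> R l m O R m n = R l n)"

definition induced_carrier :: "(nat \<Rightarrow> 'a graph) \<Rightarrow> (nat \<times> 'a) set" where
  "induced_carrier G = (SIGMA n:UNIV. verts (G n))"

definition induced_order ::
  "(nat \<Rightarrow> 'a graph) \<Rightarrow> (nat \<Rightarrow> nat \<Rightarrow> ('a \<times> 'a) set) \<Rightarrow> (nat \<times> 'a) rel" where
  "induced_order G R =
     {((n, p), (m, q)) | n p m q. p \<in> verts (G n) \<and> q \<in> verts (G m) \<and> m \<le> n \<and> (q, p) \<in> R m n}"

lemma partial_order_induced_order:
  assumes "graph_sequence Mor G R"
  shows "partial_order_on (induced_carrier G) (induced_order G R)"
proof -
  have id: "R n n = Id_on (verts (G n))" for n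
    using assms by (auto simp: graph_sequence_def)
  have comp: "R l m O R m n = R l n" if "l \<le> m" "m \<le> n" for l m n
    using assms that by (auto simp: graph_sequence_def)
  have "refl_on (induced_carrier G) (induced_order G R)"
    by (auto simp: refl_on_def induced_carrier_def induced_order_def id)
  moreover have "trans (induced_order G R)"
  proof (rule transI)
    fix x y z
    assume "(x, y) \<in> induced_order G R" "(y, z) \<in> induced_order G R"
    then obtain n p m q l s where
      xyz: "x = (n, p)" "y = (m, q)" "z = (l, s)"
      and v: "p \<in> verts (G n)" "s \<in> verts (G l)" and le: "l \<le> m" "m \<le> n"
      and r: "(q, p) \<in> R m n" "(s, q) \<in> R l m"
      unfolding induced_order_def by auto
    have "(s, p) \<in> R l n"
      using comp[OF le] r by blast
    with xyz v le show "(x, z) \<in> induced_order G R"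
      unfolding induced_order_def by auto
  qed
  moreover have "antisym (induced_order G R)"
  proof (rule antisymI)
    fix x y
    assume "(x, y) \<in> induced_order G R" "(y, x) \<in> induced_order G R"
    then show "x = y"
      unfolding induced_order_def using id by (auto dest!: le_antisym)
  qed
  moreover have "induced_order G R \<subseteq> induced_carrier G \<times> induced_carrier G"
    by (auto simp: induced_order_def induced_carrier_def)
  ultimately show ?thesis
    by (simp add: partial_order_on_def preorder_on_def)
qed


section \<open>Spectra of posets\<close>

text \<open>A poset is given by its carrier \<open>P\<close> and its order \<open>r\<close>, where \<open>(p, q) \<in> r\<close> means \<open>p \<le> q\<close>.\<close>

definition poset_band :: "'p set \<Rightarrow> 'p rel \<Rightarrow> 'p set \<Rightarrow> bool" where
  "poset_band P r B \<longleftrightarrow>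
     finite B \<and> B \<subseteq> P \<and> (\<forall>p\<in>P. \<exists>b\<in>B. (p, b) \<in> r \<or> (b, p) \<in> r)"

definition poset_cap :: "'p set \<Rightarrow> 'p rel \<Rightarrow> 'p set \<Rightarrow> bool" where
  "poset_cap P r C \<longleftrightarrow> C \<subseteq> P \<and> (\<exists>B. poset_band P r B \<and> (\<forall>b\<in>B. \<exists>c\<in>C. (b, c) \<in> r))"

definition poset_selector :: "'p set \<Rightarrow> 'p rel \<Rightarrow> 'p set \<Rightarrow> bool" where
  "poset_selector P r S \<longleftrightarrow> S \<subseteq> P \<and> (\<forall>C. poset_cap P r C \<longrightarrow> S \<inter> C \<noteq> {})"

definition spectrum_points :: "'p set \<Rightarrow> 'p rel \<Rightarrow> 'p set set" where
  "spectrum_points P r =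
     {S. poset_selector P r S \<and> (\<forall>T. poset_selector P r T \<and> T \<subseteq> S \<longrightarrow> T = S)}"

text \<open>The whole set of points is added to the subbasis because the space underlying
  \<^const>\<open>topology_generated_by\<close> is only the union of the given sets.\<close>

definition spectrum :: "'p set \<Rightarrow> 'p rel \<Rightarrow> 'p set topology" where
  "spectrum P r =
     topology_generated_by
       (insert (spectrum_points P r) ((\<lambda>p. {S \<in> spectrum_points P r. p \<in> S}) ` P))"

lemma topspace_spectrum [simp]: "topspace (spectrum P r) = spectrum_points P r"
  by (auto simp: spectrum_def)

definition sequence_spectrum ::
  "(nat \<Rightarrow> 'a graph) \<Rightarrow> (nat \<Rightarrow> nat \<Rightarrow> ('a \<times> 'a) set) \<Rightarrow> (nat \<times> 'a) set topology" where
  "sequence_spectrum G R = spectrum (induced_carrier G) (induced_order G R)"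

end

(* A subcontinuum X of the Cantor fan with a ramification point has at least three nondegenerate
   spokes, for otherwise it would embed in the real line, and by connectedness it is closed under
   moving down along a spoke. Level k cuts the spokes at the heights i / 2^k and groups them by the
   first k bits of their address in the Cantor space. The resulting half-open tiles are the vertices
   of a graph fan. A tile of height j on level k + 1 is related both to the floor and to the
   ceiling of j / 2 at level k, the latter only if that vertex exists. These relations are
   L-morphisms (X-morphisms if all spokes are full). Every point has a neighbourhood whose tiles of
   level k + 1 all lie below the tile of level k containing the point, and stars of tiles shrink to
   points. By compactness, points then correspond to minimal selectors. *)
theory Submission
  imports Defs
begin

section \<open>Graphs and morphisms of graph fans\<close>

text \<open>The link between order and topology is that the caps are exactly the sets of elements
  whose open sets cover the space. The complement of a selector is not a cap, so its open sets miss
  some point, and the selector contains every element whose open set contains that point. The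
  obstacle in building the levels is that spokes with a common prefix may differ in length. A vertex
  of a group exists as soon as one spoke of the group reaches its grid height. The point reached has
  a grid height on the next level too, in one of the two subgroups, and this is what makes the
  relations co-bijective. The other subgroup may be shorter or even absent, so lengths need not
  double. A ceiling may then be missing while a floor always exists, and monotonicity is derived
  from floors.\<close>

lemma connected_subset_rooted:
  assumes "S \<subseteq> verts G" "sym (adj G)" "r \<in> S"
    and "\<And>v. v \<in> S \<Longrightarrow> v \<noteq> r \<Longrightarrow> \<exists>u\<in>S. (u, v) \<in> adj G \<and> h u < (h v :: nat)"
  shows "connected_subset G S"
  unfolding connected_subset_def
proof (intro conjI notI)
  \<comment> \<open>Whichever part contains \<open>r\<close> absorbs all of \<open>S\<close>, since
    every other vertex has a neighbour of smaller \<open>h\<close>.\<close>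
  have all: "S \<subseteq> A" if "r \<in> A" "A \<union> B = S" "adj G \<inter> A \<times> B = {}" for A B
  proof
    fix v assume "v \<in> S"
    then show "v \<in> A"
    proof (induction "h v" arbitrary: v rule: less_induct)
      case less
      show ?case
      proof (cases "v = r")
        case False
        then obtain u where "u \<in> S" "(u, v) \<in> adj G" "h u < h v"
          using assms(4) less.prems by blast
        then show ?thesis
          using less that by blast
      qed (use that in simp)
    qed
  qed
  assume "\<exists>A B. A \<noteq> {} \<and> B \<noteq> {} \<and> A \<inter> B = {} \<and> A \<union> B = S \<and> adj G \<inter> A \<times> B = {}"
  then obtain A B where AB: "A \<noteq> {}" "B \<noteq> {}" "A \<inter> B = {}" "A \<union> B = S" "adj G \<inter> A \<times> B = {}"
    by blast
  have "adj G \<inter> B \<times> A = {}"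
    using AB(5) assms(2) by (auto dest: symD)
  then show False
    using all[of A B] all[of B A] AB assms(3) by blast
qed (fact assms)

text \<open>On a cycle, a vertex of maximal rank has two distinct neighbours of no larger rank,
  which the uniqueness of such neighbours forbids.\<close>

lemma acyclic_graph_rank:
  assumes uniq: "\<And>u u' v. (u, v) \<in> adj G \<Longrightarrow> (u', v) \<in> adj G \<Longrightarrow> u \<noteq> v \<Longrightarrow> u' \<noteq> v \<Longrightarrow>
      h u \<le> h v \<Longrightarrow> h u' \<le> (h v :: nat) \<Longrightarrow> u = u'"
    and sym: "sym (adj G)"
  shows "acyclic_graph G"
  unfolding acyclic_graph_def
proof
  assume "\<exists>xs. graph_cycle G xs"
  then obtain xs where len: "length xs \<ge> 3" and d: "distinct xs"
    and s: "successively (\<lambda>x y. (x, y) \<in> adj G) xs" and l: "(last xs, hd xs) \<in> adj G"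
    unfolding graph_cycle_def by blast
  define k where "k = length xs"
  have k: "k \<ge> 3" using len k_def by simp
  have ne: "xs \<noteq> []" using len by auto
  have step: "(xs ! i, xs ! (Suc i mod k)) \<in> adj G" if "i < k" for i
  proof (cases "Suc i < k")
    case True
    then show ?thesis using s successively_nth[OF s] by (simp add: k_def)
  next
    case False
    then have "Suc i = k" using that by simp
    then have "i = k - 1" "Suc i mod k = 0" by auto
    then show ?thesis using l ne by (simp add: last_conv_nth hd_conv_nth k_def)
  qed
  obtain i where i: "i < k" "\<And>j. j < k \<Longrightarrow> h (xs ! j) \<le> h (xs ! i)"
  proof -
    have "Max ((\<lambda>i. h (xs ! i)) ` {..<k}) \<in> (\<lambda>i. h (xs ! i)) ` {..<k}"
      using k by (intro Max_in) (auto simp: lessThan_empty_iff)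
    then obtain i where "i < k" "h (xs ! i) = Max ((\<lambda>i. h (xs ! i)) ` {..<k})" by auto
    then show ?thesis by (intro that[of i]) auto
  qed
  \<comment> \<open>\<open>p\<close> and \<open>q\<close> are the cyclic predecessor and successor
    of \<open>i\<close>; they differ because a cycle has at least three vertices.\<close>
  define p where "p = (if i = 0 then k - 1 else i - 1)"
  define q where "q = (if Suc i = k then 0 else Suc i)"
  have pq: "p < k" "q < k" "p \<noteq> i" "q \<noteq> i" "p \<noteq> q" "Suc p mod k = i" "Suc i mod k = q"
    using k i(1) by (auto simp: p_def q_def)
  have "(xs ! p, xs ! i) \<in> adj G" "(xs ! q, xs ! i) \<in> adj G"
    using step[OF pq(1)] step[OF i(1)] pq sym by (auto dest: symD)
  then have "xs ! p = xs ! q"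
    using pq i d by (intro uniq[of _ "xs ! i"]) (auto simp: nth_eq_iff_index_eq k_def)
  then show False
    using pq d by (simp add: nth_eq_iff_index_eq k_def)
qed

lemma sym_adj_induced: "sym (adj G) \<Longrightarrow> sym (adj (induced_graph G S))"
  by (auto simp: induced_graph_def sym_def)

lemma verts_induced [simp]: "verts (induced_graph G S) = S"
  by (simp add: induced_graph_def)

lemma adj_induced [simp]: "adj (induced_graph G S) = adj G \<inter> S \<times> S"
  by (simp add: induced_graph_def)

lemma fan_root_props:
  assumes "graph_fan G"
  shows "fan_root G \<in> verts G" "vertex_degree G (fan_root G) \<ge> 3"
proof -
  have "\<exists>!r. r \<in> verts G \<and> vertex_degree G r \<ge> 3"
    using assms by (simp add: graph_fan_def)
  from theI'[OF this] show "fan_root G \<in> verts G" "vertex_degree G (fan_root G) \<ge> 3"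
    by (auto simp: fan_root_def)
qed

lemma L_morphism_Id:
  assumes "graph_fan G"
  shows "L_morphism G G (Id_on (verts G))"
proof -
  have "monotone_rel (induced_graph G S) (induced_graph G S) (Id_on (verts G) \<inter> S \<times> S)"
    if "S \<in> spokes G" for S
  proof -
    have "(Id_on (verts G) \<inter> S \<times> S) `` C = C" if "C \<subseteq> S" for C
      using that \<open>S \<in> spokes G\<close> by (auto simp: spokes_def)
    then show ?thesis
      unfolding monotone_rel_def by (metis connected_subset_def verts_induced)
  qed
  moreover have "(Id_on (verts G))\<inverse> `` S \<subseteq> S" for S
    by auto
  moreover have "(Id_on (verts G))\<inverse> `` {fan_root G} = {fan_root G}"
    using fan_root_props[OF assms] by auto
  ultimately have "spoke_monotone G G (Id_on (verts G))"
    unfolding spoke_monotone_def by blast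
  moreover have "co_bijective G G (Id_on (verts G))"
    unfolding co_bijective_def by auto
  moreover have "edge_preserving G G (Id_on (verts G))"
    unfolding edge_preserving_def by auto
  ultimately show ?thesis
    using assms by (auto simp: L_morphism_def)
qed

lemma L_morphism_comp:
  assumes R: "L_morphism G H R" and Q: "L_morphism H K Q"
  shows "L_morphism G K (Q O R)"
proof -
  have sub: "R \<subseteq> verts H \<times> verts G" "Q \<subseteq> verts K \<times> verts H"
    using R Q by (auto simp: L_morphism_def)
  have "co_bijective G K (Q O R)"
    unfolding co_bijective_def
  proof (intro conjI ballI)
    fix g assume "g \<in> verts G"
    then obtain h where "(h, g) \<in> R" "h \<in> verts H"
      using R sub unfolding L_morphism_def co_bijective_def by blast
    moreover then obtain k where "(k, h) \<in> Q"
      using Q unfolding L_morphism_def co_bijective_def by blast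
    ultimately show "(Q O R)\<inverse> `` {g} \<noteq> {}" by auto
  next
    fix k assume "k \<in> verts K"
    then obtain h where h: "h \<in> verts H" "Q\<inverse> `` {h} = {k}"
      using Q by (auto simp: L_morphism_def co_bijective_def)
    then obtain g where g: "g \<in> verts G" "R\<inverse> `` {g} = {h}"
      using R by (auto simp: L_morphism_def co_bijective_def)
    have "(Q O R)\<inverse> `` {g} = {k}" using h(2) g(2) by auto
    then show "\<exists>g\<in>verts G. (Q O R)\<inverse> `` {g} = {k}" using g by blast
  qed
  moreover have "edge_preserving G K (Q O R)"
    using R Q unfolding L_morphism_def edge_preserving_def by blast
  moreover have "spoke_monotone G K (Q O R)"
    unfolding spoke_monotone_def
  proof (intro conjI ballI)
    have "R\<inverse> `` {fan_root G} = {fan_root H}" "Q\<inverse> `` {fan_root H} = {fan_root K}"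
      using R Q by (auto simp: L_morphism_def spoke_monotone_def)
    then show "(Q O R)\<inverse> `` {fan_root G} = {fan_root K}"
      by (simp add: converse_relcomp relcomp_Image)
    fix S assume "S \<in> spokes G"
    then obtain T where T: "T \<in> spokes H" "R\<inverse> `` S \<subseteq> T"
      "monotone_rel (induced_graph G S) (induced_graph H T) (R \<inter> T \<times> S)"
      using R unfolding L_morphism_def spoke_monotone_def by blast
    then obtain U where U: "U \<in> spokes K" "Q\<inverse> `` T \<subseteq> U"
      "monotone_rel (induced_graph H T) (induced_graph K U) (Q \<inter> U \<times> T)"
      using Q unfolding L_morphism_def spoke_monotone_def by blast
    \<comment> \<open>Restricting to spokes loses nothing, since \<open>R\<close> sends
      \<open>S\<close> into \<open>T\<close>.\<close>
    have "(Q O R) \<inter> U \<times> S = (Q \<inter> U \<times> T) O (R \<inter> T \<times> S)"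
      using T(2) U(2) by auto
    then have "monotone_rel (induced_graph G S) (induced_graph K U) ((Q O R) \<inter> U \<times> S)"
      using T(3) U(3) unfolding monotone_rel_def by (simp add: relcomp_Image)
    moreover have "(Q O R)\<inverse> `` S \<subseteq> U" using T(2) U(2) by blast
    ultimately show "\<exists>U\<in>spokes K. (Q O R)\<inverse> `` S \<subseteq> U \<and>
        monotone_rel (induced_graph G S) (induced_graph K U) ((Q O R) \<inter> U \<times> S)"
      using U(1) by blast
  qed
  ultimately show ?thesis
    using R Q sub unfolding L_morphism_def by blast
qed

lemma X_morphism_Id:
  assumes "graph_fan G"
  shows "X_morphism G G (Id_on (verts G))"
  using L_morphism_Id[OF assms] by (auto simp: X_morphism_def end_preserving_def)

lemma X_morphism_comp:
  assumes "X_morphism G H R" "X_morphism H K Q"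
  shows "X_morphism G K (Q O R)"
  using assms L_morphism_comp[of G H R K Q]
  unfolding X_morphism_def end_preserving_def by blast

section \<open>Sequences generated by one-step relations\<close>

primrec composites :: "(nat \<Rightarrow> 'a graph) \<Rightarrow> (nat \<Rightarrow> ('a \<times> 'a) set) \<Rightarrow> nat \<Rightarrow> nat \<Rightarrow> ('a \<times> 'a) set" where
  "composites G B m 0 = Id_on (verts (G m))"
| "composites G B m (Suc d) = composites G B m d O B (m + d)"

definition bonding :: "(nat \<Rightarrow> 'a graph) \<Rightarrow> (nat \<Rightarrow> ('a \<times> 'a) set) \<Rightarrow> nat \<Rightarrow> nat \<Rightarrow> ('a \<times> 'a) set" where
  "bonding G B m n = composites G B m (n - m)"

lemma bonding_refl: "bonding G B n n = Id_on (verts (G n))"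
  by (simp add: bonding_def)

lemma bonding_Suc: "m \<le> n \<Longrightarrow> bonding G B m (Suc n) = bonding G B m n O B n"
  by (simp add: bonding_def Suc_diff_le)

lemma graph_sequence_bonding:
  assumes step: "\<And>n. Mor (G (Suc n)) (G n) (B n)"
    and Id: "\<And>n. Mor (G n) (G n) (Id_on (verts (G n)))"
    and comp: "\<And>F H K R Q. Mor F H R \<Longrightarrow> Mor H K Q \<Longrightarrow> Mor F K (Q O R)"
    and sub: "\<And>n. B n \<subseteq> verts (G n) \<times> verts (G (Suc n))"
  shows "graph_sequence Mor G (bonding G B)"
  unfolding graph_sequence_def
proof (intro conjI allI impI)
  fix m n :: nat assume "m \<le> n"
  then show "Mor (G n) (G m) (bonding G B m n)"
    by (induction n rule: dec_induct) (auto simp: bonding_refl bonding_Suc Id intro: comp step)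
next
  \<comment> \<open>Composing with the identity on level \<open>m\<close> is neutral only for
    relations whose sources all lie in that level.\<close>
  have sub': "bonding G B l m \<subseteq> UNIV \<times> verts (G m)" if "l \<le> m" for l m
    using that by (induction m rule: dec_induct) (use sub in \<open>auto simp: bonding_refl bonding_Suc\<close>)
  fix l m n :: nat assume "l \<le> m \<and> m \<le> n"
  then have "m \<le> n" and lm: "l \<le> m" by auto
  then show "bonding G B l m O bonding G B m n = bonding G B l n"
  proof (induction n rule: dec_induct)
    case base
    then show ?case using sub'[OF lm] by (auto simp: bonding_refl)
  next
    case (step n)
    then show ?case by (simp add: bonding_Suc O_assoc[symmetric])
  qed
qed (simp add: bonding_refl)

section \<open>Coded fans\<close>

definition col :: "nat \<Rightarrow> nat" where "col v = fst (prod_decode v)"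

definition hgt :: "nat \<Rightarrow> nat" where "hgt v = snd (prod_decode v)"

definition vtx :: "nat \<Rightarrow> nat \<Rightarrow> nat" where "vtx a i = (if i = 0 then 0 else prod_encode (a, i))"

text \<open>The vertex at height \<open>i\<close> of the spoke numbered \<open>a\<close> is \<^term>\<open>vtx a i\<close>. All spokes share the
  root \<open>0\<close>, whose \<^const>\<open>col\<close> is meaningless.\<close>

lemma hgt_0 [simp]: "hgt 0 = 0"
  by (simp add: hgt_def prod_decode_def prod_decode_aux.simps)

lemma hgt_vtx [simp]: "hgt (vtx a i) = i"
  by (auto simp: vtx_def) (simp add: hgt_def)

lemma col_vtx: "i > 0 \<Longrightarrow> col (vtx a i) = a"
  by (simp add: vtx_def col_def)

lemma vtx_0 [simp]: "vtx a 0 = 0"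
  by (simp add: vtx_def)

lemma vtx_col_hgt: "hgt v > 0 \<Longrightarrow> vtx (col v) (hgt v) = v"
  by (simp add: vtx_def hgt_def col_def)

text \<open>\<open>N a\<close> is the height of the spoke \<open>a\<close>, so that spokes with \<open>N a = 0\<close> are absent.\<close>

definition fan_verts :: "(nat \<Rightarrow> nat) \<Rightarrow> nat set" where
  "fan_verts N = {v. v = 0 \<or> (hgt v > 0 \<and> hgt v \<le> N (col v))}"

text \<open>Heights differing by at most one include equal heights, so the relation is reflexive.
  The disjuncts for height 0 replace the comparison of columns at the root, which belongs to every
  spoke.\<close>

definition coded_fan :: "(nat \<Rightarrow> nat) \<Rightarrow> nat graph" where
  "coded_fan N = \<lparr>verts = fan_verts N,
     adj = {(u, v). u \<in> fan_verts N \<and> v \<in> fan_verts N \<and> hgt u \<le> Suc (hgt v) \<and> hgt v \<le> Suc (hgt u) \<and>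
       (hgt u = 0 \<or> hgt v = 0 \<or> col u = col v)}\<rparr>"

definition coded_spoke :: "(nat \<Rightarrow> nat) \<Rightarrow> nat \<Rightarrow> nat set" where
  "coded_spoke N a = {v \<in> fan_verts N. hgt v = 0 \<or> col v = a}"

lemma verts_coded_fan [simp]: "verts (coded_fan N) = fan_verts N"
  by (simp add: coded_fan_def)

lemma adj_coded_fan: "(u, v) \<in> adj (coded_fan N) \<longleftrightarrow>
    u \<in> fan_verts N \<and> v \<in> fan_verts N \<and> hgt u \<le> Suc (hgt v) \<and> hgt v \<le> Suc (hgt u) \<and>
       (hgt u = 0 \<or> hgt v = 0 \<or> col u = col v)"
  by (simp add: coded_fan_def)

lemma zero_in_fan_verts [simp]: "0 \<in> fan_verts N"
  by (simp add: fan_verts_def)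

lemma fan_verts_hgt0: "v \<in> fan_verts N \<Longrightarrow> hgt v = 0 \<Longrightarrow> v = 0"
  by (auto simp: fan_verts_def)

lemma fan_verts_eqI:
  assumes "u \<in> fan_verts N" "v \<in> fan_verts N'" "hgt u = hgt v" "hgt u = 0 \<or> col u = col v"
  shows "u = v"
  by (metis assms fan_verts_hgt0 vtx_col_hgt not_gr_zero)

lemma vtx_in_fan_verts: "i \<le> N a \<Longrightarrow> vtx a i \<in> fan_verts N"
  by (cases "i = 0") (auto simp: fan_verts_def col_vtx)

lemma fan_verts_hgt_le: "v \<in> fan_verts N \<Longrightarrow> hgt v \<le> N (col v)"
  by (auto simp: fan_verts_def)

lemma sym_adj_coded_fan: "sym (adj (coded_fan N))"
  by (auto simp: sym_def adj_coded_fan)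

lemma zero_in_coded_spoke [simp]: "0 \<in> coded_spoke N a"
  by (simp add: coded_spoke_def)

lemma vtx_in_coded_spoke: "i \<le> N a \<Longrightarrow> vtx a i \<in> coded_spoke N a"
  by (cases "i = 0") (auto simp: coded_spoke_def vtx_in_fan_verts col_vtx)

lemma coded_spoke_eq: "v \<in> coded_spoke N a \<longleftrightarrow> (\<exists>i\<le>N a. v = vtx a i)"
proof
  assume "v \<in> coded_spoke N a"
  then have v: "v \<in> fan_verts N" "hgt v = 0 \<or> col v = a" by (auto simp: coded_spoke_def)
  show "\<exists>i\<le>N a. v = vtx a i"
  proof (cases "hgt v = 0")
    case True
    then show ?thesis using v fan_verts_hgt0 by (intro exI[of _ 0]) auto
  next
    case False
    then show ?thesis using v vtx_col_hgt[of v] fan_verts_hgt_le[OF v(1)]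
      by (intro exI[of _ "hgt v"]) auto
  qed
qed (auto intro: vtx_in_coded_spoke)

lemma adj_vtx:
  assumes "i \<le> N a" "j \<le> N a"
  shows "(vtx a i, vtx a j) \<in> adj (coded_fan N) \<longleftrightarrow> i \<le> Suc j \<and> j \<le> Suc i"
  using assms by (cases "i = 0"; cases "j = 0") (auto simp: adj_coded_fan vtx_in_fan_verts col_vtx)

lemma vtx_eq_iff: "vtx a i = vtx a j \<longleftrightarrow> i = j"
  by (metis hgt_vtx)

lemma vtx_eq_0_iff [simp]: "vtx a i = 0 \<longleftrightarrow> i = 0"
  by (metis hgt_vtx hgt_0 vtx_0)

lemma vtx_pos_iff [simp]: "0 < vtx a i \<longleftrightarrow> 0 < i"
  using vtx_eq_0_iff[of a i] by linarith

lemma finite_fan_verts: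
  assumes "finite {a. N a > 0}"
  shows "finite (fan_verts N)"
proof (rule finite_subset)
  show "fan_verts N \<subseteq> insert 0 (\<Union>a\<in>{a. N a > 0}. vtx a ` {..N a})"
  proof
    fix v assume v: "v \<in> fan_verts N"
    show "v \<in> insert 0 (\<Union>a\<in>{a. N a > 0}. vtx a ` {..N a})"
    proof (cases "hgt v = 0")
      case True
      then show ?thesis using v fan_verts_hgt0 by auto
    next
      case False
      then have "v = vtx (col v) (hgt v)" "N (col v) > 0" "hgt v \<le> N (col v)"
        using fan_verts_hgt_le[OF v] vtx_col_hgt[of v] by auto
      then show ?thesis by auto
    qed
  qed
qed (use assms in simp)

text \<open>Adjacent vertices of equal height coincide, so a different neighbour that is not higher
  lies one step closer to the root, and there is only one such position. This is the uniqueness that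
  excludes cycles, and it passes to induced subgraphs.\<close>

lemma coded_fan_parent_unique:
  assumes "(u, v) \<in> adj (coded_fan N)" "(u', v) \<in> adj (coded_fan N)" "u \<noteq> v" "u' \<noteq> v"
    "hgt u \<le> hgt v" "hgt u' \<le> hgt v"
  shows "u = u'"
proof -
  have *: "hgt w = hgt v - 1 \<and> (hgt w = 0 \<or> col w = col v) \<and> hgt v > 0 \<and> w \<in> fan_verts N"
    if "(w, v) \<in> adj (coded_fan N)" "w \<noteq> v" "hgt w \<le> hgt v" for w
  proof -
    have w: "w \<in> fan_verts N" "v \<in> fan_verts N" "hgt v \<le> Suc (hgt w)" "hgt w = 0 \<or> hgt v = 0 \<or> col w = col v"
      using that(1) by (auto simp: adj_coded_fan)
    moreover have "hgt w \<noteq> hgt v"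
      using fan_verts_eqI[of w N v N] w that(2) by auto
    ultimately show ?thesis
      using that(3) by auto
  qed
  from *[OF assms(1,3,5)] *[OF assms(2,4,6)] show ?thesis
    using fan_verts_eqI[of u N u' N] by auto
qed

lemma acyclic_coded_fan: "acyclic_graph (coded_fan N)"
  by (rule acyclic_graph_rank[where h = hgt]) (use coded_fan_parent_unique sym_adj_coded_fan in auto)

lemma acyclic_induced_coded_fan: "acyclic_graph (induced_graph (coded_fan N) S)"
  by (rule acyclic_graph_rank[where h = hgt])
    (use coded_fan_parent_unique[of _ _ N] in \<open>auto intro!: sym_adj_induced simp: sym_adj_coded_fan sym_adj_induced[unfolded adj_induced]\<close>)

lemma connected_coded_fan: "connected_subset (coded_fan N) (fan_verts N)"
proof (rule connected_subset_rooted[where r = 0 and h = hgt])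
  fix v assume v: "v \<in> fan_verts N" "v \<noteq> 0"
  then have "hgt v > 0" using fan_verts_hgt0 by blast
  then have "v = vtx (col v) (hgt v)" "hgt v \<le> N (col v)"
    using vtx_col_hgt[of v] fan_verts_hgt_le[OF v(1)] by auto
  then show "\<exists>u\<in>fan_verts N. (u, v) \<in> adj (coded_fan N) \<and> hgt u < hgt v"
    using adj_vtx[of "hgt v - 1" N "col v" "hgt v"] \<open>hgt v > 0\<close>
    by (intro bexI[of _ "vtx (col v) (hgt v - 1)"]) (auto intro: vtx_in_fan_verts)
qed (auto simp: sym_adj_coded_fan)

text \<open>A spoke is a path, so its connected subsets are the order-convex sets of heights.
  Monotonicity thereby becomes a matter of inequalities between heights.\<close>

lemma connected_subset_coded_spoke:
  "connected_subset (induced_graph (coded_fan N) (coded_spoke N a)) C \<longleftrightarrow>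
     C \<subseteq> coded_spoke N a \<and>
     (\<forall>i j k. vtx a i \<in> C \<and> vtx a k \<in> C \<and> i \<le> j \<and> j \<le> k \<longrightarrow> vtx a j \<in> C)"
  (is "?L \<longleftrightarrow> ?R")
proof
  assume L: ?L
  then have sub: "C \<subseteq> coded_spoke N a" by (simp add: connected_subset_def)
  have "vtx a j \<in> C" if ik: "vtx a i \<in> C" "vtx a k \<in> C" "i \<le> j" "j \<le> k" for i j k
  proof (rule ccontr)
    assume nj: "vtx a j \<notin> C"
    \<comment> \<open>Vertices on either side of the missing height \<open>j\<close> differ in
      height by at least two, so no edge joins them.\<close>
    define A where "A = {v \<in> C. hgt v < j}"
    define B where "B = {v \<in> C. hgt v > j}"
    have "i \<noteq> j" "k \<noteq> j" using nj ik by auto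
    then have "vtx a i \<in> A" "vtx a k \<in> B" using ik by (auto simp: A_def B_def)
    moreover have "A \<inter> B = {}" by (auto simp: A_def B_def)
    moreover have "A \<union> B = C"
    proof -
      have "hgt v \<noteq> j" if v: "v \<in> C" for v
      proof -
        obtain l where "v = vtx a l" using sub v coded_spoke_eq[of v N a] by blast
        then show ?thesis using nj v by auto
      qed
      then show ?thesis by (auto simp: A_def B_def) (meson linorder_neqE_nat)
    qed
    moreover have "adj (coded_fan N) \<inter> A \<times> B = {}"
      by (auto simp: A_def B_def adj_coded_fan)
    ultimately show False
      using L unfolding connected_subset_def by (metis (no_types, lifting) Int_commute Int_empty_right
          adj_induced empty_iff inf_assoc)
  qed
  with sub show ?R by blast
next
  assume R: ?R
  show ?L
  proof (cases "C = {}")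
    case True
    then show ?thesis by (auto simp: connected_subset_def)
  next
    case False
    then obtain v where "v \<in> C" by blast
    then obtain i where "vtx a i \<in> C" using R coded_spoke_eq[of v N a] by blast
    then have l: "vtx a (LEAST i. vtx a i \<in> C) \<in> C" by (rule LeastI)
    define l where "l = (LEAST i. vtx a i \<in> C)"
    have lC: "vtx a l \<in> C" using l by (simp add: l_def)
    show ?thesis
    proof (rule connected_subset_rooted[OF _ _ lC, where h = hgt])
      fix v assume v: "v \<in> C" "v \<noteq> vtx a l"
      then obtain j where j: "v = vtx a j" "j \<le> N a" using R coded_spoke_eq[of v N a] by blast
      then have "l < j" using v l_def Least_le[of "\<lambda>i. vtx a i \<in> C" j] by (simp add: vtx_eq_iff le_neq_implies_less)
      have jC: "vtx a (j - 1) \<in> C"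
        using R lC v(1) j(1) \<open>l < j\<close> by (metis diff_le_self less_imp_diff_less Suc_pred' less_Suc_eq_le gr_implies_not0 not_gr_zero)
      show "\<exists>u\<in>C. (u, v) \<in> adj (induced_graph (coded_fan N) (coded_spoke N a)) \<and> hgt u < hgt v"
      proof (intro bexI[OF _ jC] conjI)
        have "vtx a (j - 1) \<in> coded_spoke N a" "vtx a j \<in> coded_spoke N a"
          using R jC v(1) j(1) by blast+
        then show "(vtx a (j - 1), v) \<in> adj (induced_graph (coded_fan N) (coded_spoke N a))"
          using adj_vtx[of "j - 1" N a j] j by auto
        show "hgt (vtx a (j - 1)) < hgt v"
          using j \<open>l < j\<close> by simp
      qed
    qed (use R in \<open>auto intro!: sym_adj_induced simp: sym_adj_coded_fan simp del: adj_induced\<close>)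
  qed
qed


lemma card_path_neighbours:
  fixes i n :: nat
  assumes "i \<le> n"
  shows "card {k. k \<le> n \<and> k \<noteq> i \<and> k \<le> Suc i \<and> i \<le> Suc k} = of_bool (i > 0) + of_bool (i < n)"
proof -
  have "{k. k \<le> n \<and> k \<noteq> i \<and> k \<le> Suc i \<and> i \<le> Suc k} =
      (if i > 0 then {i - 1} else {}) \<union> (if i < n then {Suc i} else {})"
    using assms by auto
  then show ?thesis by auto
qed

lemma degree_in_coded_spoke:
  assumes "i \<le> N a"
  shows "vertex_degree (induced_graph (coded_fan N) (coded_spoke N a)) (vtx a i) =
    of_bool (i > 0) + of_bool (i < N a)"
proof -
  have "{g' \<in> coded_spoke N a. g' \<noteq> vtx a i \<and>
        (g', vtx a i) \<in> adj (induced_graph (coded_fan N) (coded_spoke N a))} =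
      vtx a ` {k. k \<le> N a \<and> k \<noteq> i \<and> k \<le> Suc i \<and> i \<le> Suc k}"
    using assms by (auto simp: coded_spoke_eq adj_vtx vtx_eq_iff)
  then show ?thesis
    using assms by (simp add: vertex_degree_def card_image inj_on_def vtx_eq_iff card_path_neighbours)
qed

lemma degree_in_coded_fan:
  assumes "0 < i" "i \<le> N a"
  shows "vertex_degree (coded_fan N) (vtx a i) = 1 + of_bool (i < N a)"
proof -
  \<comment> \<open>Away from the root all neighbours of a vertex lie on its spoke, so the degree
    can be computed there.\<close>
  have "{g' \<in> fan_verts N. g' \<noteq> vtx a i \<and> (g', vtx a i) \<in> adj (coded_fan N)} =
      {g' \<in> coded_spoke N a. g' \<noteq> vtx a i \<and>
        (g', vtx a i) \<in> adj (induced_graph (coded_fan N) (coded_spoke N a))}"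
    using assms by (auto simp: adj_coded_fan coded_spoke_def col_vtx)
  then have "vertex_degree (coded_fan N) (vtx a i) =
      vertex_degree (induced_graph (coded_fan N) (coded_spoke N a)) (vtx a i)"
    by (simp add: vertex_degree_def)
  then show ?thesis
    using degree_in_coded_spoke[of i N a] assms by simp
qed

lemma fan_verts_cases:
  assumes "v \<in> fan_verts N"
  obtains "v = 0" | a i where "v = vtx a i" "0 < i" "i \<le> N a"
proof (cases "hgt v = 0")
  case True
  then show ?thesis using assms that fan_verts_hgt0 by blast
next
  case False
  then show ?thesis
    using that(2)[of "col v" "hgt v"] vtx_col_hgt[of v] fan_verts_hgt_le[OF assms] by simp
qed

text \<open>Finitely many spokes keep the graph finite, and three of them give the root degree at
  least 3.\<close>

definition fan_lengths :: "(nat \<Rightarrow> nat) \<Rightarrow> bool" where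
  "fan_lengths N \<longleftrightarrow> finite {a. N a > 0} \<and> card {a. N a > 0} \<ge> 3"

lemma degree_root:
  assumes "fan_lengths N"
  shows "vertex_degree (coded_fan N) 0 \<ge> 3"
proof -
  have "(\<lambda>a. vtx a 1) ` {a. N a > 0} \<subseteq> {g' \<in> fan_verts N. g' \<noteq> 0 \<and> (g', 0) \<in> adj (coded_fan N)}"
    by (auto simp: adj_coded_fan vtx_in_fan_verts Suc_leI)
  moreover have "finite {g' \<in> fan_verts N. g' \<noteq> 0 \<and> (g', 0) \<in> adj (coded_fan N)}"
    using finite_fan_verts assms by (simp add: fan_lengths_def)
  ultimately have "card ((\<lambda>a. vtx a 1) ` {a. N a > 0}) \<le> vertex_degree (coded_fan N) 0"
    unfolding vertex_degree_def by (auto intro: card_mono)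
  moreover have "inj_on (\<lambda>a. vtx a 1) {a. N a > 0}"
    by (auto simp: inj_on_def) (metis One_nat_def col_vtx zero_less_one)
  ultimately show ?thesis
    using assms by (simp add: card_image fan_lengths_def)
qed

lemma degree_nonroot:
  assumes "v \<in> fan_verts N" "v \<noteq> 0"
  shows "vertex_degree (coded_fan N) v \<le> 2"
  using assms(1) by (rule fan_verts_cases) (use assms(2) in \<open>auto simp: degree_in_coded_fan\<close>)

lemma root_unique:
  assumes "fan_lengths N"
  shows "v \<in> fan_verts N \<and> vertex_degree (coded_fan N) v \<ge> 3 \<longleftrightarrow> v = 0"
  using degree_root[OF assms] degree_nonroot[of v N] by fastforce

lemma is_graph_coded_fan:
  assumes "fan_lengths N"
  shows "is_graph (coded_fan N)"
  using finite_fan_verts[of N] assms sym_adj_coded_fan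
  unfolding is_graph_def fan_lengths_def refl_on_def
  by (auto simp: adj_coded_fan) (metis empty_iff zero_in_fan_verts)

lemma graph_fan_coded_fan:
  assumes "fan_lengths N"
  shows "graph_fan (coded_fan N)"
  using is_graph_coded_fan[OF assms] connected_coded_fan acyclic_coded_fan root_unique[OF assms]
  by (simp add: graph_fan_def)

lemma fan_root_coded_fan:
  assumes "fan_lengths N"
  shows "fan_root (coded_fan N) = 0"
  using root_unique[OF assms] by (simp add: fan_root_def)

lemma graph_ends_coded_fan:
  assumes "fan_lengths N"
  shows "graph_ends (coded_fan N) = {v \<in> fan_verts N. hgt v > 0 \<and> hgt v = N (col v)}"
proof -
  have "vertex_degree (coded_fan N) v \<le> 1 \<longleftrightarrow> hgt v > 0 \<and> hgt v = N (col v)" if "v \<in> fan_verts N" for v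
    using that
  proof (cases rule: fan_verts_cases)
    case 1
    then show ?thesis using degree_root[OF assms] by simp
  next
    case (2 a i)
    then show ?thesis by (auto simp: degree_in_coded_fan col_vtx)
  qed
  then show ?thesis by (auto simp: graph_ends_def)
qed

lemma coded_spoke_in_spokes:
  assumes N: "fan_lengths N" and a: "N a > 0"
  shows "coded_spoke N a \<in> spokes (coded_fan N)"
proof -
  let ?S = "coded_spoke N a"
  let ?H = "induced_graph (coded_fan N) ?S"
  have sub: "?S \<subseteq> fan_verts N" by (auto simp: coded_spoke_def)
  have "is_graph ?H"
    using is_graph_coded_fan[OF N] sub finite_subset[OF sub]
    by (auto simp: is_graph_def refl_on_def sym_def) (metis empty_iff zero_in_coded_spoke)
  moreover have "connected_subset ?H ?S"
    unfolding connected_subset_coded_spoke by (auto simp: coded_spoke_eq vtx_eq_iff)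
  moreover have "vertex_degree ?H g \<le> 2" if "g \<in> ?S" for g
    using that degree_in_coded_spoke[of _ N a] by (auto simp: coded_spoke_eq)
  ultimately have "path_graph ?H"
    by (simp add: path_graph_def acyclic_induced_coded_fan)
  moreover have "graph_ends ?H = {0, vtx a (N a)}"
  proof -
    have "graph_ends ?H = vtx a ` {i. i \<le> N a \<and> of_bool (i > 0) + of_bool (i < N a) \<le> (1::nat)}"
      using degree_in_coded_spoke[of 0 N a]
      by (auto simp: graph_ends_def coded_spoke_eq degree_in_coded_spoke)
    also have "{i. i \<le> N a \<and> of_bool (i > 0) + of_bool (i < N a) \<le> (1::nat)} = {0, N a}"
      using a by (auto simp: of_bool_def split: if_splits)
    finally show ?thesis by simp
  qed
  moreover have "vtx a (N a) \<in> graph_ends (coded_fan N)"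
    using a by (auto simp: graph_ends_coded_fan[OF N] vtx_in_fan_verts col_vtx)
  ultimately show ?thesis
    using sub by (auto simp: spokes_def fan_root_coded_fan[OF N])
qed

text \<open>On the spoke \<open>a\<close>, the part above height \<open>j\<close> is joined to the
  rest of the fan only through \<open>vtx a j\<close>, so a connected set with the root and a vertex
  of that part cannot omit it.\<close>

lemma connected_subset_coded_fan_below:
  assumes conn: "connected_subset (induced_graph (coded_fan N) S) S" and S: "S \<subseteq> fan_verts N"
    and "0 \<in> S" "vtx a i \<in> S" "j \<le> i"
  shows "vtx a j \<in> S"
proof (rule ccontr)
  assume nj: "vtx a j \<notin> S"
  then have "j > 0" using assms(3) by (cases j) auto
  have "j < i" using nj assms(4,5) by (metis le_neq_implies_less)
  define A where "A = {v \<in> S. hgt v > j \<and> col v = a}"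
  define B where "B = S - A"
  have "vtx a i \<in> A" using assms(4) \<open>j < i\<close> by (simp add: A_def col_vtx)
  moreover have "0 \<in> B" using assms(3) by (simp add: A_def B_def)
  moreover have "A \<inter> B = {}" "A \<union> B = S" by (auto simp: A_def B_def)
  moreover have "adj (induced_graph (coded_fan N) S) \<inter> A \<times> B = {}"
  proof -
    have False if uv: "u \<in> A" "v \<in> B" "(u, v) \<in> adj (coded_fan N)" for u v
    proof -
      have u: "hgt u > j" "col u = a" using uv by (auto simp: A_def)
      have v: "v \<in> S" "\<not> (hgt v > j \<and> col v = a)" using uv by (auto simp: A_def B_def)
      have "hgt u \<le> Suc (hgt v)" "hgt v = 0 \<or> col v = a"
        using uv(3) u by (auto simp: adj_coded_fan)
      then have "hgt v = j" "col v = a" using u v \<open>j > 0\<close> by auto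
      then have "v = vtx a j" using \<open>j > 0\<close> vtx_col_hgt[of v] by simp
      then show False using nj v by simp
    qed
    then show ?thesis by auto
  qed
  ultimately show False
    using conn unfolding connected_subset_def by (metis empty_iff)
qed

text \<open>A path that has the root as an end contains only one neighbour of the root, so it stays
  on one spoke, and connectedness fills this spoke up to its end.\<close>

lemma spokes_coded_fan:
  assumes N: "fan_lengths N"
  shows "spokes (coded_fan N) = coded_spoke N ` {a. N a > 0}"
proof
  show "coded_spoke N ` {a. N a > 0} \<subseteq> spokes (coded_fan N)"
    using coded_spoke_in_spokes[OF N] by auto
  show "spokes (coded_fan N) \<subseteq> coded_spoke N ` {a. N a > 0}"
  proof
    fix S assume "S \<in> spokes (coded_fan N)"
    then obtain e where sub: "S \<subseteq> fan_verts N" and p: "path_graph (induced_graph (coded_fan N) S)"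
      and e: "e \<in> graph_ends (coded_fan N)" and ends: "graph_ends (induced_graph (coded_fan N) S) = {0, e}"
      by (auto simp: spokes_def fan_root_coded_fan[OF N])
    define a where "a = col e"
    have ea: "N a > 0" "e = vtx a (N a)"
      using e vtx_col_hgt[of e] by (auto simp: graph_ends_coded_fan[OF N] a_def)
    have "0 \<in> graph_ends (induced_graph (coded_fan N) S)" "e \<in> graph_ends (induced_graph (coded_fan N) S)"
      using ends by auto
    then have 0: "0 \<in> S" and deg: "vertex_degree (induced_graph (coded_fan N) S) 0 \<le> 1"
      and eS: "vtx a (N a) \<in> S"
      using ea by (auto simp: graph_ends_def)
    have conn: "connected_subset (induced_graph (coded_fan N) S) S"
      using p by (simp add: path_graph_def)
    note below = connected_subset_coded_fan_below[OF conn sub 0]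
    have "finite S" using p by (simp add: path_graph_def is_graph_def)
    have "S \<subseteq> coded_spoke N a"
    proof
      fix v assume v: "v \<in> S"
      then have "v \<in> fan_verts N" using sub by blast
      then show "v \<in> coded_spoke N a"
      proof (cases rule: fan_verts_cases)
        case (2 b i)
        have 1: "vtx a 1 \<in> S" "vtx b 1 \<in> S"
          using below[OF eS, of 1] below[of b i 1] v 2 ea by auto
        have "b = a"
        proof (rule ccontr)
          assume "b \<noteq> a"
          then have "card {vtx a 1, vtx b 1} = 2"
            by (metis card_2_iff col_vtx zero_less_one)
          moreover have "{vtx a 1, vtx b 1} \<subseteq>
              {g' \<in> S. g' \<noteq> 0 \<and> (g', 0) \<in> adj (induced_graph (coded_fan N) S)}"
            using 1 0 sub by (auto simp: adj_coded_fan)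
          ultimately show False
            using deg card_mono[of "{g' \<in> S. g' \<noteq> 0 \<and> (g', 0) \<in> adj (induced_graph (coded_fan N) S)}"
                "{vtx a 1, vtx b 1}"] \<open>finite S\<close>
            by (simp add: vertex_degree_def)
        qed
        then show ?thesis using 2 vtx_in_coded_spoke by simp
      qed simp
    qed
    moreover have "coded_spoke N a \<subseteq> S"
      using below[OF eS] by (auto simp: coded_spoke_eq)
    ultimately show "S \<in> coded_spoke N ` {a. N a > 0}" using ea by blast
  qed
qed

text \<open>Relating odd heights to both neighbours makes consecutive vertices overlap; with floors alone
  the spectrum would be totally disconnected.\<close>

definition refinement :: "(nat \<Rightarrow> nat) \<Rightarrow> (nat \<Rightarrow> nat) \<Rightarrow> (nat \<times> nat) set" where
  "refinement N N' = {(u, v). u \<in> fan_verts N \<and> v \<in> fan_verts N' \<and>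
     (hgt u = hgt v div 2 \<or> hgt u = Suc (hgt v) div 2) \<and> (hgt u = 0 \<or> col u = col v div 2)}"

text \<open>\<open>floor_le\<close> makes the relation total, because the floor of every vertex
  exists. \<open>double_le\<close> gives each non-root vertex a child at twice its height, which is
  related to that vertex alone.\<close>

locale fan_refinement =
  fixes N N' :: "nat \<Rightarrow> nat"
  assumes N: "fan_lengths N" and N': "fan_lengths N'"
    and floor_le: "\<And>a j. j \<le> N' a \<Longrightarrow> j div 2 \<le> N (a div 2)"
    and double_le: "\<And>a i. 0 < i \<Longrightarrow> i \<le> N a \<Longrightarrow> \<exists>a'. a' div 2 = a \<and> 2 * i \<le> N' a'"
begin

lemma floor_refinement:
  assumes "v \<in> fan_verts N'"
  shows "(vtx (col v div 2) (hgt v div 2), v) \<in> refinement N N'"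
proof -
  have "vtx (col v div 2) (hgt v div 2) \<in> fan_verts N"
    using floor_le[OF fan_verts_hgt_le[OF assms]] by (rule vtx_in_fan_verts)
  moreover have "col (vtx (col v div 2) (hgt v div 2)) = col v div 2" if "hgt v div 2 \<noteq> 0"
    using that by (intro col_vtx) simp
  ultimately show ?thesis using assms by (auto simp: refinement_def)
qed

lemma co_bijective_refinement: "co_bijective (coded_fan N') (coded_fan N) (refinement N N')"
  unfolding co_bijective_def verts_coded_fan
proof (intro conjI ballI)
  fix g assume "g \<in> fan_verts N'"
  then show "(refinement N N')\<inverse> `` {g} \<noteq> {}"
    using floor_refinement by blast
next
  fix h assume "h \<in> fan_verts N"
  then show "\<exists>g\<in>fan_verts N'. (refinement N N')\<inverse> `` {g} = {h}"
  proof (cases rule: fan_verts_cases)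
    case 1
    have "(refinement N N')\<inverse> `` {0} = {0}"
      using fan_verts_hgt0 by (auto simp: refinement_def)
    then show ?thesis using 1 by (intro bexI[of _ 0]) auto
  next
    case (2 a i)
    then obtain a' where a': "a' div 2 = a" "2 * i \<le> N' a'" using double_le by blast
    \<comment> \<open>At even heights floor and ceiling agree, so \<open>vtx a' (2 * i)\<close> has
      no image besides \<open>vtx a i\<close>.\<close>
    have g: "vtx a' (2 * i) \<in> fan_verts N'" using a' by (intro vtx_in_fan_verts)
    have "u = vtx a i" if "(u, vtx a' (2 * i)) \<in> refinement N N'" for u
    proof (rule fan_verts_eqI)
      show "u \<in> fan_verts N" "vtx a i \<in> fan_verts N"
        using that 2 by (auto simp: refinement_def vtx_in_fan_verts)
      show "hgt u = hgt (vtx a i)" "hgt u = 0 \<or> col u = col (vtx a i)"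
        using that a' 2 by (auto simp: refinement_def col_vtx)
    qed
    moreover have "(vtx a i, vtx a' (2 * i)) \<in> refinement N N'"
      using g 2 a' by (auto simp: refinement_def col_vtx vtx_in_fan_verts)
    ultimately have "(refinement N N')\<inverse> `` {vtx a' (2 * i)} = {h}" unfolding 2(1) by blast
    then show ?thesis using g by blast
  qed
qed

lemma edge_preserving_refinement: "edge_preserving (coded_fan N') (coded_fan N) (refinement N N')"
  unfolding edge_preserving_def
proof (intro allI impI, elim conjE)
  fix h g h' g'
  assume hg: "(h, g) \<in> refinement N N'" "(h', g') \<in> refinement N N'" and gg: "(g, g') \<in> adj (coded_fan N')"
  \<comment> \<open>For \<open>j \<le> j' + 1\<close> the ceiling of \<open>j / 2\<close> exceeds
    the floor of \<open>j' / 2\<close> by at most one; this covers all combinations of roundings at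
    once.\<close>
  have close: "hgt x \<le> Suc (hgt x')"
    if "(x, y) \<in> refinement N N'" "(x', y') \<in> refinement N N'" "hgt y \<le> Suc (hgt y')" for x y x' y'
  proof -
    have "hgt x \<le> Suc (hgt y) div 2" "hgt y' div 2 \<le> hgt x'"
      using that by (auto simp: refinement_def)
    moreover have "Suc (hgt y) div 2 \<le> Suc (Suc (hgt y')) div 2"
      using that(3) by (intro div_le_mono) simp
    ultimately show ?thesis by simp
  qed
  have "hgt h \<le> Suc (hgt h')" "hgt h' \<le> Suc (hgt h)"
    using close[OF hg] close[OF hg(2,1)] gg by (auto simp: adj_coded_fan)
  moreover have "hgt h = 0 \<or> hgt h' = 0 \<or> col h = col h'"
    using hg gg by (auto simp: refinement_def adj_coded_fan)
  ultimately show "(h, h') \<in> adj (coded_fan N)"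
    using hg by (auto simp: refinement_def adj_coded_fan)
qed

text \<open>For \<open>j1 < j\<close> the ceiling of \<open>j1 / 2\<close> is at most the floor of
  \<open>j / 2\<close>. So the floor of an intermediate height stays between the two given images,
  and it always exists. The assumption says that the source spoke lies over \<open>a\<close> as soon
  as one of its floors is not the root.\<close>

lemma monotone_refinement:
  assumes a': "\<And>v. v \<in> coded_spoke N' a' \<Longrightarrow> hgt v div 2 \<noteq> 0 \<Longrightarrow> a' div 2 = a"
  shows "monotone_rel (induced_graph (coded_fan N') (coded_spoke N' a'))
    (induced_graph (coded_fan N) (coded_spoke N a)) (refinement N N' \<inter> coded_spoke N a \<times> coded_spoke N' a')"
    (is "monotone_rel _ _ ?R")
  unfolding monotone_rel_def connected_subset_coded_spoke
proof (intro allI impI, elim conjE, intro conjI allI impI, goal_cases)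
  case (1 C)
  then show ?case by auto
next
  case (2 C j1 j j2)
  then have C: "\<And>i k l. vtx a i \<in> C \<Longrightarrow> vtx a l \<in> C \<Longrightarrow> i \<le> k \<Longrightarrow> k \<le> l \<Longrightarrow> vtx a k \<in> C"
    and "vtx a' j1 \<in> ?R `` C" "vtx a' j2 \<in> ?R `` C" and j: "j1 \<le> j" "j \<le> j2"
    by blast+
  then obtain u1 u2 where u: "u1 \<in> C" "u2 \<in> C" "(u1, vtx a' j1) \<in> ?R" "(u2, vtx a' j2) \<in> ?R"
    by blast
  then obtain i1 i2 where i: "u1 = vtx a i1" "u2 = vtx a i2"
    by (auto simp: coded_spoke_eq)
  show ?case
  \<comment> \<open>The lower end is treated apart because its image may be a ceiling that exceeds
    its floor.\<close>
  proof (cases "j = j1")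
    case True
    then show ?thesis using 2 by simp
  next
    case False
    have "i1 \<le> Suc j1 div 2" "j2 div 2 \<le> i2"
      using u i by (auto simp: refinement_def)
    then have "i1 \<le> j div 2" "j div 2 \<le> i2"
      using False j by (auto intro: order_trans div_le_mono)
    then have C': "vtx a (j div 2) \<in> C"
      using C[of i1 i2 "j div 2"] u i by simp
    have "vtx a' j2 \<in> coded_spoke N' a'" using u by blast
    then have jN: "j \<le> N' a'" using j by (auto simp: coded_spoke_eq vtx_eq_iff)
    have S: "vtx a' j \<in> coded_spoke N' a'" using jN by (rule vtx_in_coded_spoke)
    have V: "vtx a' j \<in> fan_verts N'" using S by (simp add: coded_spoke_def)
    have "vtx (col (vtx a' j) div 2) (j div 2) = vtx a (j div 2)"
      using a'[OF S] by (cases "j div 2 = 0") (auto simp: col_vtx)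
    then have "(vtx a (j div 2), vtx a' j) \<in> refinement N N'"
      using floor_refinement[OF V] by simp
    moreover have "vtx a (j div 2) \<in> coded_spoke N a" using C' 2 by blast
    ultimately show ?thesis using C' S by blast
  qed
qed

lemma L_morphism_refinement: "L_morphism (coded_fan N') (coded_fan N) (refinement N N')"
proof -
  have "spoke_monotone (coded_fan N') (coded_fan N) (refinement N N')"
    unfolding spoke_monotone_def fan_root_coded_fan[OF N] fan_root_coded_fan[OF N'] spokes_coded_fan[OF N]
      spokes_coded_fan[OF N']
  proof (intro conjI ballI)
    show "(refinement N N')\<inverse> `` {0} = {0}"
      using fan_verts_hgt0 by (auto simp: refinement_def)
    fix S assume "S \<in> coded_spoke N' ` {a. N' a > 0}"
    then obtain a' where S: "S = coded_spoke N' a'" by blast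
    obtain b where b: "N b > 0"
      using N by (metis (mono_tags, lifting) card.empty empty_Collect_eq fan_lengths_def not_numeral_le_zero)
    \<comment> \<open>If the parent spoke \<open>a' div 2\<close> is absent, then the spoke
      \<open>a'\<close> has height at most 1 and collapses to the root, so any spoke
      \<open>b\<close> can serve as target.\<close>
    define a where "a = (if N (a' div 2) > 0 then a' div 2 else b)"
    have a: "N a > 0" using b by (simp add: a_def)
    have zero: "hgt u = 0" if "(u, v) \<in> refinement N N'" "v \<in> S" "N (a' div 2) = 0" for u v
    proof (rule ccontr)
      assume "hgt u \<noteq> 0"
      then have "hgt v \<noteq> 0" "col u = col v div 2" "u \<in> fan_verts N" using that by (auto simp: refinement_def)
      then have "hgt u \<le> N (a' div 2)"
        using that S fan_verts_hgt_le[of u N] by (auto simp: coded_spoke_def)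
      then show False using \<open>hgt u \<noteq> 0\<close> that by simp
    qed
    have "a' div 2 = a" if "v \<in> coded_spoke N' a'" "hgt v div 2 \<noteq> 0" for v
    proof -
      have "v \<in> fan_verts N'" "col v = a'" using that by (auto simp: coded_spoke_def)
      then have "hgt v div 2 \<le> N (a' div 2)"
        using floor_le[of "hgt v" a'] fan_verts_hgt_le[of v N'] by simp
      then show ?thesis using that by (auto simp: a_def)
    qed
    from monotone_refinement[OF this]
    have mon: "monotone_rel (induced_graph (coded_fan N') S) (induced_graph (coded_fan N) (coded_spoke N a))
        (refinement N N' \<inter> coded_spoke N a \<times> S)"
      unfolding S .
    have "(refinement N N')\<inverse> `` S \<subseteq> coded_spoke N a"
    proof
      fix u assume "u \<in> (refinement N N')\<inverse> `` S"
      then obtain v where v: "(u, v) \<in> refinement N N'" "v \<in> S" by blast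
      show "u \<in> coded_spoke N a"
      proof (cases "N (a' div 2) > 0")
        case True
        then show ?thesis using v S by (auto simp: refinement_def coded_spoke_def a_def)
      next
        case False
        then show ?thesis using zero[OF v] v by (auto simp: coded_spoke_def refinement_def)
      qed
    qed
    with mon a show "\<exists>T\<in>coded_spoke N ` {a. N a > 0}. (refinement N N')\<inverse> `` S \<subseteq> T \<and>
        monotone_rel (induced_graph (coded_fan N') S) (induced_graph (coded_fan N) T) (refinement N N' \<inter> T \<times> S)"
      by blast
  qed
  then show ?thesis
    using graph_fan_coded_fan[OF N] graph_fan_coded_fan[OF N'] co_bijective_refinement edge_preserving_refinement
    by (auto simp: L_morphism_def refinement_def)
qed

text \<open>When lengths double exactly, ends have even height, so rounding takes them to the full
  length of the parent spoke.\<close>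

lemma X_morphism_refinement:
  assumes "\<And>a. N' a = 2 * N (a div 2)"
  shows "X_morphism (coded_fan N') (coded_fan N) (refinement N N')"
proof -
  have "u \<in> fan_verts N \<and> hgt u > 0 \<and> hgt u = N (col u)"
    if "(u, v) \<in> refinement N N'" "hgt v > 0" "hgt v = N' (col v)" for u v
    using that assms[of "col v"] by (auto simp: refinement_def)
  then show ?thesis
    unfolding X_morphism_def end_preserving_def graph_ends_coded_fan[OF N] graph_ends_coded_fan[OF N']
    using L_morphism_refinement by blast
qed

end

section \<open>The spectrum of a sequence of fans\<close>

locale fan_sequence =
  fixes G :: "nat \<Rightarrow> 'v graph" and R :: "nat \<Rightarrow> nat \<Rightarrow> ('v \<times> 'v) set"
  assumes seq: "graph_sequence L_morphism G R"
begin

abbreviation "P \<equiv> induced_carrier G"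

abbreviation "r \<equiv> induced_order G R"

lemma R_refl: "R n n = Id_on (verts (G n))"
  using seq by (simp add: graph_sequence_def)

lemma R_comp: "(u, v) \<in> R l m \<Longrightarrow> (v, w) \<in> R m n \<Longrightarrow> l \<le> m \<Longrightarrow> m \<le> n \<Longrightarrow> (u, w) \<in> R l n"
  using seq unfolding graph_sequence_def by blast

lemma R_sub: "m \<le> n \<Longrightarrow> R m n \<subseteq> verts (G m) \<times> verts (G n)"
  using seq by (simp add: graph_sequence_def L_morphism_def)

lemma R_total: "m \<le> n \<Longrightarrow> v \<in> verts (G n) \<Longrightarrow> \<exists>u. (u, v) \<in> R m n"
  using seq unfolding graph_sequence_def L_morphism_def co_bijective_def by fast

lemma R_onto: "m \<le> n \<Longrightarrow> u \<in> verts (G m) \<Longrightarrow> \<exists>v. (u, v) \<in> R m n"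
  using seq unfolding graph_sequence_def L_morphism_def co_bijective_def by fast

lemma order_iff: "((n, v), (m, u)) \<in> r \<longleftrightarrow> m \<le> n \<and> (u, v) \<in> R m n"
  using R_sub[of m n] by (auto simp: induced_order_def)

lemma in_carrier: "(n, v) \<in> P \<longleftrightarrow> v \<in> verts (G n)"
  by (simp add: induced_carrier_def)

lemma poset_band_level: "poset_band P r (Pair n ` verts (G n))"
  unfolding poset_band_def
proof (intro conjI ballI)
  have "graph_fan (G n)"
    using seq by (auto simp: graph_sequence_def L_morphism_def)
  then show "finite (Pair n ` verts (G n))"
    by (simp add: graph_fan_def is_graph_def)
  fix p assume "p \<in> P"
  then obtain m u where p: "p = (m, u)" "u \<in> verts (G m)"
    by (auto simp: induced_carrier_def)
  show "\<exists>b\<in>Pair n ` verts (G n). (p, b) \<in> r \<or> (b, p) \<in> r"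
  proof (cases "n \<le> m")
    case True
    then obtain v where "(v, u) \<in> R n m" using R_total p by blast
    then show ?thesis using True p R_sub[of n m] by (auto simp: order_iff)
  next
    case False
    then obtain v where "(u, v) \<in> R m n" using R_onto[of m n u] p by auto
    then show ?thesis using False p R_sub[of m n] by (auto simp: order_iff)
  qed
qed (auto simp: in_carrier)

text \<open>A band is finite, so some level lies strictly beyond it, and the elements of that level
  can be comparable to elements of the band only from below. Conversely, every level is itself a
  band.\<close>

lemma poset_cap_iff:
  "poset_cap P r C \<longleftrightarrow> C \<subseteq> P \<and> (\<exists>n. \<forall>v\<in>verts (G n). \<exists>c\<in>C. ((n, v), c) \<in> r)"
proof
  assume "C \<subseteq> P \<and> (\<exists>n. \<forall>v\<in>verts (G n). \<exists>c\<in>C. ((n, v), c) \<in> r)"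
  then show "poset_cap P r C"
    unfolding poset_cap_def using poset_band_level by blast
next
  assume "poset_cap P r C"
  then obtain B where B: "poset_band P r B" "\<And>b. b \<in> B \<Longrightarrow> \<exists>c\<in>C. (b, c) \<in> r" and C: "C \<subseteq> P"
    unfolding poset_cap_def by blast
  have "finite (fst ` B)" using B(1) by (simp add: poset_band_def)
  then obtain n where n: "\<forall>b\<in>B. fst b < n"
    using finite_nat_set_iff_bounded[of "fst ` B"] by auto
  have "\<exists>c\<in>C. ((n, v), c) \<in> r" if v: "v \<in> verts (G n)" for v
  proof -
    obtain b where b: "b \<in> B" "((n, v), b) \<in> r \<or> (b, (n, v)) \<in> r"
      using B(1) v unfolding poset_band_def by (metis in_carrier)
    obtain m u where mu: "b = (m, u)" by fastforce
    then have "((n, v), b) \<in> r" using b n by (auto simp: order_iff)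
    moreover obtain c where c: "c \<in> C" "(b, c) \<in> r" using B(2) b by blast
    obtain k w where kw: "c = (k, w)" by fastforce
    have "((n, v), c) \<in> r"
      using calculation c mu kw R_comp[of w u k m v n] by (auto simp: order_iff)
    then show ?thesis using c by blast
  qed
  with C show "C \<subseteq> P \<and> (\<exists>n. \<forall>v\<in>verts (G n). \<exists>c\<in>C. ((n, v), c) \<in> r)"
    by blast
qed

end

text \<open>The vertex \<open>\<tau> n x\<close> is the label of the level \<open>n\<close> tile containing the point \<open>x\<close>. The tiles of a
  level only partition the space. An element \<open>p\<close> of the poset stands for the open set of all points
  that have a neighbourhood tiled, at some level, by elements below \<open>p\<close>.\<close>

locale tiled_space = fan_sequence G R
  for G :: "nat \<Rightarrow> 'v graph" and R :: "nat \<Rightarrow> nat \<Rightarrow> ('v \<times> 'v) set" +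
  fixes X :: "'a topology" and \<tau> :: "nat \<Rightarrow> 'a \<Rightarrow> 'v"
  assumes compact: "compact_space X" and T0: "t0_space X"
    and tile_onto: "\<tau> n ` topspace X = verts (G n)"
    and tile_mono: "m \<le> n \<Longrightarrow> x \<in> topspace X \<Longrightarrow> (\<tau> m x, \<tau> n x) \<in> R m n"
    and tile_nbhd: "x \<in> topspace X \<Longrightarrow>
      \<exists>n\<ge>m. \<exists>W. openin X W \<and> x \<in> W \<and> (\<forall>z\<in>W. (\<tau> m x, \<tau> n z) \<in> R m n)"
    and tile_small: "openin X V \<Longrightarrow> x \<in> V \<Longrightarrow>
      \<exists>n\<ge>k. \<exists>W. openin X W \<and> x \<in> W \<and>
        (\<forall>z\<in>W. \<forall>l\<ge>n. \<forall>q. (q, \<tau> l z) \<in> R n l \<longrightarrow>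
          (\<forall>z'\<in>topspace X. \<forall>l'\<ge>n. (q, \<tau> l' z') \<in> R n l' \<longrightarrow> z' \<in> V))"
begin

definition nb :: "nat \<times> 'v \<Rightarrow> 'a set" where
  "nb p = \<Union>{W. openin X W \<and> (\<exists>n\<ge>fst p. \<forall>z\<in>W. (snd p, \<tau> n z) \<in> R (fst p) n)}"

lemma nb_iff: "x \<in> nb (m, u) \<longleftrightarrow>
    (\<exists>W n. openin X W \<and> x \<in> W \<and> n \<ge> m \<and> (\<forall>z\<in>W. (u, \<tau> n z) \<in> R m n))"
  by (auto simp: nb_def)

lemma openin_nb: "openin X (nb p)"
  by (auto simp: nb_def)

lemma nb_mono: 
  assumes "(p, q) \<in> r"
  shows "nb p \<subseteq> nb q"
proof -
  obtain n v m u where pq: "p = (n, v)" "q = (m, u)" by fastforce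
  then have mn: "m \<le> n" and "(u, v) \<in> R m n" using assms by (auto simp: order_iff)
  then have *: "(u, w) \<in> R m k" if "(v, w) \<in> R n k" "n \<le> k" for w k
    using R_comp that by blast
  show ?thesis
  proof
    fix x assume "x \<in> nb p"
    then obtain W k where W: "openin X W" "x \<in> W" "k \<ge> n" "\<forall>z\<in>W. (v, \<tau> k z) \<in> R n k"
      unfolding pq nb_iff by blast
    then have "\<forall>z\<in>W. (u, \<tau> k z) \<in> R m k" using * by blast
    then show "x \<in> nb q" unfolding pq nb_iff using W order_trans[OF mn] by blast
  qed
qed

lemma nb_tile: "x \<in> topspace X \<Longrightarrow> x \<in> nb (m, \<tau> m x)"
  using tile_nbhd[of x m] unfolding nb_iff by blast

lemma nb_below:
  assumes "x \<in> nb (m, u)"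
  shows "x \<in> topspace X" "\<exists>n\<ge>m. (u, \<tau> n x) \<in> R m n"
  using assms openin_subset unfolding nb_iff by blast+

lemma tile_in: "x \<in> topspace X \<Longrightarrow> \<tau> n x \<in> verts (G n)"
  using tile_onto by blast

lemma tile_ex: "v \<in> verts (G n) \<Longrightarrow> \<exists>x\<in>topspace X. \<tau> n x = v"
  using tile_onto[of n] by (metis imageE)

lemma nb_base:
  assumes "openin X V" "x \<in> V"
  shows "\<exists>n. nb (n, \<tau> n x) \<subseteq> V"
proof -
  obtain n W where n: "x \<in> W" "\<And>z l q z' l'. \<lbrakk>z \<in> W; l \<ge> n; (q, \<tau> l z) \<in> R n l; z' \<in> topspace X; l' \<ge> n;
      (q, \<tau> l' z') \<in> R n l'\<rbrakk> \<Longrightarrow> z' \<in> V"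
    using tile_small[OF assms] by metis
  have x: "x \<in> topspace X" using assms openin_subset by blast
  have "z \<in> V" if z: "z \<in> nb (n, \<tau> n x)" for z
  proof -
    obtain l where "l \<ge> n" "(\<tau> n x, \<tau> l z) \<in> R n l" using nb_below(2)[OF z] by blast
    moreover have "z \<in> topspace X" using nb_below(1)[OF z] .
    \<comment> \<open>The shared label \<open>q\<close> is \<open>\<tau> n x\<close> itself, read at
      level \<open>n\<close> for \<open>x\<close> and at level \<open>l\<close> for
      \<open>z\<close>.\<close>
    ultimately show ?thesis using n(2)[OF n(1) le_refl tile_mono[OF le_refl x]] by blast
  qed
  then show ?thesis by blast
qed

text \<open>This turns membership in an open set into order relations on a single level: near
  \<open>x\<close>, all elements of level \<open>n\<close> already lie below \<open>(m, u)\<close>.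
  Both the caps obtained from covers and the minimality of the selectors rest on it.\<close>

lemma nb_refine:
  assumes "x \<in> nb (m, u)"
  shows "\<exists>W n. openin X W \<and> x \<in> W \<and> n \<ge> m \<and> (\<forall>v\<in>verts (G n). nb (n, v) \<inter> W \<noteq> {} \<longrightarrow> (u, v) \<in> R m n)"
proof -
  obtain V k where V: "openin X V" "x \<in> V" "k \<ge> m" "\<And>z. z \<in> V \<Longrightarrow> (u, \<tau> k z) \<in> R m k"
    using assms unfolding nb_iff by blast
  obtain n W where n: "n \<ge> k" "openin X W" "x \<in> W"
    "\<And>z l q z' l'. \<lbrakk>z \<in> W; l \<ge> n; (q, \<tau> l z) \<in> R n l; z' \<in> topspace X; l' \<ge> n;
      (q, \<tau> l' z') \<in> R n l'\<rbrakk> \<Longrightarrow> z' \<in> V"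
    using tile_small[OF V(1,2), of k] by metis
  have "(u, v) \<in> R m n" if v: "v \<in> verts (G n)" "nb (n, v) \<inter> W \<noteq> {}" for v
  proof -
    obtain z where z: "z \<in> nb (n, v)" "z \<in> W" using v by blast
    then obtain l where l: "l \<ge> n" "(v, \<tau> l z) \<in> R n l" using nb_below by blast
    \<comment> \<open>A point \<open>z'\<close> labelled \<open>v\<close> shares \<open>v\<close>
      with a point near \<open>x\<close>, so it falls into \<open>V\<close>, where the tiles of
      level \<open>k\<close> lie below \<open>u\<close>; and \<open>v\<close> lies below the level
      \<open>k\<close> tile of \<open>z'\<close>.\<close>
    obtain z' where z': "z' \<in> topspace X" "\<tau> n z' = v" using tile_ex v by blast
    then have "z' \<in> V" using n(4)[OF z(2) l z'(1) le_refl] v(1) by (auto simp: R_refl)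
    then show ?thesis using R_comp[OF V(4) _ V(3) n(1)] tile_mono[OF n(1) z'(1)] z' by blast
  qed
  with n V(3) show ?thesis by (intro exI[of _ W] exI[of _ n]) auto
qed

section \<open>Caps as open covers, points as minimal selectors\<close>

lemma poset_cap_cover:
  assumes A: "A \<subseteq> P" and cover: "topspace X \<subseteq> (\<Union>p\<in>A. nb p)"
  shows "poset_cap P r A"
proof -
  define Q where "Q x p W n \<longleftrightarrow> p \<in> A \<and> openin X W \<and> x \<in> W \<and> n \<ge> fst p \<and>
      (\<forall>v\<in>verts (G n). nb (n, v) \<inter> W \<noteq> {} \<longrightarrow> (snd p, v) \<in> R (fst p) n)" for x p W n
  have "\<exists>p W n. Q x p W n" if x: "x \<in> topspace X" for x
  proof -
    obtain m u where mu: "(m, u) \<in> A" "x \<in> nb (m, u)" using cover x by fastforce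
    from nb_refine[OF mu(2)] obtain W n where "openin X W" "x \<in> W" "n \<ge> m"
      "\<forall>v\<in>verts (G n). nb (n, v) \<inter> W \<noteq> {} \<longrightarrow> (u, v) \<in> R m n"
      by blast
    then have "Q x (m, u) W n" using mu unfolding Q_def by simp
    then show ?thesis by blast
  qed
  then obtain p W n where Q: "\<And>x. x \<in> topspace X \<Longrightarrow> Q x (p x) (W x) (n x)"
    by metis
  note pWn = Q[unfolded Q_def]
  have "\<forall>U\<in>W ` topspace X. openin X U" "topspace X \<subseteq> \<Union>(W ` topspace X)"
    using pWn by blast+
  then have "\<exists>\<F>. finite \<F> \<and> \<F> \<subseteq> W ` topspace X \<and> topspace X \<subseteq> \<Union>\<F>"
    using compact unfolding compact_space_def compactin_def by meson
  then obtain F where F: "finite F" "F \<subseteq> topspace X" "topspace X \<subseteq> (\<Union>x\<in>F. W x)"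
    by (metis finite_subset_image)
  \<comment> \<open>A finite subcover involves finitely many levels, so one level \<open>N\<close>
    refines \<open>A\<close>.\<close>
  obtain N where N: "\<forall>x\<in>F. n x \<le> N"
    using F(1) finite_nat_set_iff_bounded_le[of "n ` F"] by auto
  have "\<exists>c\<in>A. ((N, v), c) \<in> r" if v: "v \<in> verts (G N)" for v
  proof -
    obtain z where z: "z \<in> topspace X" "\<tau> N z = v" using tile_ex v by blast
    then obtain x where x: "x \<in> F" "z \<in> W x" using F by blast
    then have xX: "x \<in> topspace X" "n x \<le> N" using F N by auto
    \<comment> \<open>\<open>v\<close> lies below \<open>v'\<close>, the label of the same point on
      the coarser level \<open>n x\<close>, and \<open>v'\<close> lies below \<open>p x\<close>
      because its open set meets \<open>W x\<close>.\<close>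
    define v' where "v' = \<tau> (n x) z"
    have v': "(v', v) \<in> R (n x) N" using tile_mono xX z by (auto simp: v'_def)
    have "z \<in> nb (n x, v')" using nb_tile[OF z(1)] by (simp add: v'_def)
    then have "(snd (p x), v') \<in> R (fst (p x)) (n x)"
      using pWn[OF xX(1)] x tile_in[OF z(1), of "n x"] unfolding v'_def by blast
    then have "(snd (p x), v) \<in> R (fst (p x)) N"
      using R_comp v' pWn[OF xX(1)] xX(2) by blast
    then have "((N, v), p x) \<in> r"
      using order_iff[of N v "fst (p x)" "snd (p x)"] pWn[OF xX(1)] xX(2) by simp
    then show ?thesis using pWn xX by blast
  qed
  then show ?thesis using A poset_cap_iff by blast
qed

definition point :: "'a \<Rightarrow> (nat \<times> 'v) set" where
  "point x = {p \<in> P. x \<in> nb p}"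

text \<open>Each cap is refined by a level, and the tile of \<open>x\<close> on that level has
  \<open>x\<close> in its open set, so the open sets of a cap cover the space.\<close>

lemma selector_point:
  assumes "x \<in> topspace X"
  shows "poset_selector P r (point x)"
  unfolding poset_selector_def
proof (intro conjI allI impI)
  fix C assume "poset_cap P r C"
  then obtain n where "C \<subseteq> P" "\<forall>v\<in>verts (G n). \<exists>c\<in>C. ((n, v), c) \<in> r"
    unfolding poset_cap_iff by (elim conjE exE)
  moreover from this obtain c where c: "c \<in> C" "((n, \<tau> n x), c) \<in> r"
    using tile_in[OF assms, of n] by (elim ballE bexE) auto
  moreover have "x \<in> nb c"
    using nb_tile[OF assms, of n] nb_mono[OF c(2)] by (elim subsetD)
  ultimately have "c \<in> point x \<inter> C"
    unfolding point_def by blast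
  then show "point x \<inter> C \<noteq> {}" by auto
qed (auto simp: point_def)

text \<open>The complement of a selector is not a cap, so by compactness its open sets leave a point
  uncovered.\<close>

lemma selector_contains_point:
  assumes "poset_selector P r S"
  shows "\<exists>x\<in>topspace X. point x \<subseteq> S"
proof (rule ccontr)
  assume "\<not> (\<exists>x\<in>topspace X. point x \<subseteq> S)"
  then have "topspace X \<subseteq> (\<Union>p\<in>P - S. nb p)"
    by (auto simp: point_def)
  then have "poset_cap P r (P - S)" by (intro poset_cap_cover) auto
  then show False using assms unfolding poset_selector_def by blast
qed

lemma point_minimal:
  assumes x: "x \<in> topspace X" and S: "poset_selector P r S" "S \<subseteq> point x"
  shows "S = point x"
proof -
  have "(m, u) \<in> S" if mu: "(m, u) \<in> point x" for m u
  proof -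
    obtain W n where W: "openin X W" "x \<in> W" "n \<ge> m"
      "\<And>v. v \<in> verts (G n) \<Longrightarrow> nb (n, v) \<inter> W \<noteq> {} \<Longrightarrow> (u, v) \<in> R m n"
      using nb_refine[of x m u] mu unfolding point_def by blast
    \<comment> \<open>This set leaves a selector inside \<open>point x\<close> no choice: its
      elements other than \<open>(m, u)\<close> have open sets avoiding \<open>x\<close>. It is a
      cap because the level \<open>n\<close> elements around \<open>x\<close> lie below
      \<open>(m, u)\<close>.\<close>
    define C where "C = insert (m, u) {(n, v) | v. v \<in> verts (G n) \<and> x \<notin> nb (n, v)}"
    have "poset_cap P r C"
      unfolding poset_cap_iff
    proof (intro conjI exI ballI)
      show "C \<subseteq> P" using mu by (auto simp: C_def point_def in_carrier)
      fix v assume v: "v \<in> verts (G n)"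
      show "\<exists>c\<in>C. ((n, v), c) \<in> r"
      proof (cases "x \<in> nb (n, v)")
        case True
        then have "((n, v), (m, u)) \<in> r" using W v by (auto simp: order_iff)
        then show ?thesis by (auto simp: C_def)
      next
        case False
        then show ?thesis using v by (intro bexI[of _ "(n, v)"]) (auto simp: C_def order_iff R_refl)
      qed
    qed
    then obtain c where c: "c \<in> S" "c \<in> C" using S(1) unfolding poset_selector_def by blast
    then have "x \<in> nb c" using S(2) unfolding point_def by blast
    then have "c = (m, u)" using c(2) unfolding C_def by blast
    then show ?thesis using c(1) by simp
  qed
  then show ?thesis using S by auto
qed

lemma inj_on_point: "inj_on point (topspace X)"
proof (rule inj_onI, rule ccontr)
  fix x y assume xy: "x \<in> topspace X" "y \<in> topspace X" "point x = point y" "x \<noteq> y"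
  have *: "y \<in> V" if V: "openin X V" "x \<in> V" and xy: "x \<in> topspace X" "point x = point y" for x y V
  proof -
    obtain n where n: "nb (n, \<tau> n x) \<subseteq> V" using nb_base V by blast
    have "(n, \<tau> n x) \<in> point x"
      using nb_tile[OF xy(1)] tile_in[OF xy(1)] by (simp add: point_def in_carrier)
    then show ?thesis using n xy by (auto simp: point_def)
  qed
  obtain V where "openin X V" "x \<in> V \<longleftrightarrow> y \<notin> V"
    using T0 xy unfolding t0_space_def by blast
  then show False using * xy by metis
qed

lemma point_image: "point ` topspace X = spectrum_points P r"
proof
  show "point ` topspace X \<subseteq> spectrum_points P r"
    using selector_point point_minimal by (auto simp: spectrum_points_def)
  show "spectrum_points P r \<subseteq> point ` topspace X"
  proof
    fix S assume S: "S \<in> spectrum_points P r"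
    then obtain x where "x \<in> topspace X" "point x \<subseteq> S"
      using selector_contains_point unfolding spectrum_points_def by blast
    then show "S \<in> point ` topspace X"
      using S selector_point[of x] unfolding spectrum_points_def by blast
  qed
qed

lemma openin_spectrum_subbasic:
  assumes "p \<in> P"
  shows "openin (spectrum P r) {S \<in> spectrum_points P r. p \<in> S}"
  using assms unfolding spectrum_def by (intro topology_generated_by_Basis) auto

lemma homeomorphic_sequence_spectrum: "X homeomorphic_space sequence_spectrum G R"
proof -
  have "continuous_map X (spectrum P r) point"
    unfolding spectrum_def
  proof (rule continuous_on_generated_topo)
    fix U assume "U \<in> insert (spectrum_points P r) ((\<lambda>p. {S \<in> spectrum_points P r. p \<in> S}) ` P)"
    then consider "U = spectrum_points P r" | p where "p \<in> P" "U = {S \<in> spectrum_points P r. p \<in> S}"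
      by blast
    then show "openin X (point -` U \<inter> topspace X)"
    proof cases
      case 1
      then have "point -` U \<inter> topspace X = topspace X" using point_image by auto
      then show ?thesis by simp
    next
      case 2
      then have "point -` U \<inter> topspace X = nb p"
        using point_image openin_subset[OF openin_nb[of p]] by (auto simp: point_def)
      then show ?thesis by (simp add: openin_nb)
    qed
  qed (use point_image in auto)
  moreover have "open_map X (spectrum P r) point"
    unfolding open_map_def
  proof (intro allI impI)
    fix V assume V: "openin X V"
    show "openin (spectrum P r) (point ` V)"
    proof (subst openin_subopen, intro ballI)
      fix S assume "S \<in> point ` V"
      then obtain x where x: "x \<in> V" "S = point x" by blast
      then have xX: "x \<in> topspace X" using V openin_subset by blast
      obtain n where n: "nb (n, \<tau> n x) \<subseteq> V" using nb_base[OF V x(1)] by blast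
      have p: "(n, \<tau> n x) \<in> P" using tile_in[OF xX] by (simp add: in_carrier)
      show "\<exists>T. openin (spectrum P r) T \<and> S \<in> T \<and> T \<subseteq> point ` V"
      proof (intro exI conjI)
        show "openin (spectrum P r) {S \<in> spectrum_points P r. (n, \<tau> n x) \<in> S}"
          using p by (rule openin_spectrum_subbasic)
        show "S \<in> {S \<in> spectrum_points P r. (n, \<tau> n x) \<in> S}"
          using p x xX nb_tile[OF xX] point_image by (auto simp: point_def)
        show "{S \<in> spectrum_points P r. (n, \<tau> n x) \<in> S} \<subseteq> point ` V"
          using n unfolding point_image[symmetric] by (auto simp: point_def)
      qed
    qed
  qed
  ultimately have "homeomorphic_map X (spectrum P r) point"
    by (intro bijective_open_imp_homeomorphic_map) (auto simp: point_image inj_on_point)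
  then show ?thesis
    unfolding sequence_spectrum_def by (rule homeomorphic_map_imp_homeomorphic_space)
qed

end

section \<open>Coordinates on fans\<close>

text \<open>The first bit is the most significant one, so that forgetting the last bit is division
  by 2; this is the \<open>div 2\<close> on columns in \<open>refinement\<close>.\<close>

primrec prefix_code :: "nat \<Rightarrow> (nat \<Rightarrow> bool) \<Rightarrow> nat" where
  "prefix_code 0 c = 0"
| "prefix_code (Suc n) c = 2 * prefix_code n c + of_bool (c n)"

lemma prefix_code_Suc_div: "prefix_code (Suc n) c div 2 = prefix_code n c"
  by simp

lemma prefix_code_div: "m \<le> n \<Longrightarrow> prefix_code n c div 2 ^ (n - m) = prefix_code m c"
proof (induction n rule: dec_induct)
  case (step n)
  then have "prefix_code (Suc n) c div 2 ^ (Suc n - m) = prefix_code (Suc n) c div 2 div 2 ^ (n - m)"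
    by (simp add: Suc_diff_le div_mult2_eq del: prefix_code.simps)
  then show ?case
    using step.IH prefix_code_Suc_div by simp
qed simp

lemma prefix_code_eq_iff: "prefix_code n c = prefix_code n d \<longleftrightarrow> (\<forall>k<n. c k = d k)"
proof (induction n)
  case (Suc n)
  have "prefix_code (Suc n) c = prefix_code (Suc n) d \<longleftrightarrow> prefix_code n c = prefix_code n d \<and> c n = d n"
    by (cases "c n"; cases "d n") (simp_all, presburger+)
  then show ?case using Suc by (auto simp: less_Suc_eq)
qed simp

lemma prefix_code_less: "prefix_code n c < 2 ^ n"
  by (induction n) (auto simp: of_bool_def)

lemma prefix_code_surj: "a < 2 ^ n \<Longrightarrow> \<exists>c. prefix_code n c = a"
proof (induction n arbitrary: a)
  case (Suc n)
  then have "a div 2 < 2 ^ n" by auto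
  then obtain c where c: "prefix_code n c = a div 2" using Suc.IH by blast
  have "prefix_code n (c(n := odd a)) = prefix_code n c"
    by (simp add: prefix_code_eq_iff)
  then have "prefix_code (Suc n) (c(n := odd a)) = a"
    using c by (cases "odd a") auto
  then show ?case by blast
qed simp

text \<open>A point is given by its height \<open>tt\<close> and the spoke \<open>cc\<close> containing it; at the root, \<open>cc\<close> takes an
  arbitrary value.\<close>

locale fan_coordinates =
  fixes X :: "'a topology" and cc :: "'a \<Rightarrow> nat \<Rightarrow> bool" and tt :: "'a \<Rightarrow> real"
  assumes compact_X: "compact_space X"
    and tt_range: "x \<in> topspace X \<Longrightarrow> 0 \<le> tt x \<and> tt x \<le> 1"
    and coordinates_inj: "\<lbrakk>x \<in> topspace X; y \<in> topspace X; tt x = tt y; tt x = 0 \<or> cc x = cc y\<rbrakk> \<Longrightarrow> x = y"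
    and open_lt: "openin X {x \<in> topspace X. tt x < u}"
    and open_gt: "openin X {x \<in> topspace X. tt x > u}"
    and open_bit: "openin X {x \<in> topspace X. tt x > 0 \<and> cc x k = b}"
begin

lemma open_agree: "openin X {x \<in> topspace X. tt x > 0 \<and> (\<forall>k<n. cc x k = c k)}"
proof (induction n)
  case 0
  then show ?case using open_gt[of 0] by simp
next
  case (Suc n)
  have "{x \<in> topspace X. tt x > 0 \<and> (\<forall>k<Suc n. cc x k = c k)} =
      {x \<in> topspace X. tt x > 0 \<and> (\<forall>k<n. cc x k = c k)} \<inter> {x \<in> topspace X. tt x > 0 \<and> cc x n = c n}"
    by (auto simp: less_Suc_eq)
  then show ?case using Suc open_bit by auto
qed

lemma open_disagree: "openin X {x \<in> topspace X. tt x > 0 \<and> \<not> (\<forall>k<n. cc x k = c k)}"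
proof -
  have "{x \<in> topspace X. tt x > 0 \<and> \<not> (\<forall>k<n. cc x k = c k)} =
      (\<Union>k\<in>{..<n}. {x \<in> topspace X. tt x > 0 \<and> cc x k = (\<not> c k)})"
    by auto
  then show ?thesis using open_bit by auto
qed

text \<open>By compactness, closed sets shrinking to height \<open>s\<close> and address
  \<open>c\<close> would have a common point with these coordinates. Since \<open>s\<close> and
  \<open>c\<close> need not belong to a point of the space, the lemma yields neighbourhood bases and
  also detects gaps in a spoke.\<close>

lemma closed_misses_nbhd:
  assumes K: "closedin X K" and s: "0 \<le> s"
    and miss: "\<And>y. y \<in> K \<Longrightarrow> tt y = s \<Longrightarrow> s \<noteq> 0 \<and> cc y \<noteq> c"
  shows "\<exists>n. \<forall>y\<in>K. \<not> (\<bar>tt y - s\<bar> \<le> (1/2) ^ n \<and> (s = 0 \<or> (\<forall>k<n. cc y k = c k)))"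
proof (rule ccontr)
  assume contr: "\<not> ?thesis"
  \<comment> \<open>The offset \<open>n0\<close> keeps heights within \<open>(1/2) ^ n0\<close> of a
    positive \<open>s\<close> positive. Bits are controlled only at positive height, and this is
    what makes the sets \<open>F n\<close> closed.\<close>
  obtain n0 :: nat where n0: "s = 0 \<or> (1/2) ^ n0 < s"
    using real_arch_pow_inv[of s "1/2"] s by fastforce
  define F where "F n = {y \<in> K. \<bar>tt y - s\<bar> \<le> (1/2) ^ (n + n0) \<and> (s = 0 \<or> (\<forall>k<n + n0. cc y k = c k))}" for n
  have KX: "K \<subseteq> topspace X" using K closedin_subset by blast
  have "closedin X (F n)" for n
  proof -
    define A where "A = {y \<in> topspace X. tt y < s - (1/2) ^ (n + n0)} \<union> {y \<in> topspace X. tt y > s + (1/2) ^ (n + n0)} \<union>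
        (if s = 0 then {} else {y \<in> topspace X. tt y > 0 \<and> \<not> (\<forall>k<n + n0. cc y k = c k)})"
    have "openin X A"
      unfolding A_def using open_lt open_gt open_disagree[of "n + n0" c] by (simp add: openin_Un)
    moreover have "F n = K - A"
    proof -
      define e :: real where "e = (1/2) ^ (n + n0)"
      have "e \<le> (1/2) ^ n0" unfolding e_def by (intro power_decreasing) auto
      then have pos: "s = 0 \<or> tt y > 0" if "\<not> tt y < s - e" for y
        using that n0 by linarith
      have "y \<in> F n \<longleftrightarrow> y \<notin> A" if "y \<in> K" for y
      proof -
        have "y \<in> F n \<longleftrightarrow> \<not> tt y < s - e \<and> \<not> tt y > s + e \<and> (s = 0 \<or> (\<forall>k<n + n0. cc y k = c k))"
          using that unfolding F_def e_def by auto
        moreover have "y \<in> A \<longleftrightarrow> tt y < s - e \<or> tt y > s + e \<or> s \<noteq> 0 \<and> tt y > 0 \<and> \<not> (\<forall>k<n + n0. cc y k = c k)"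
          using that KX unfolding A_def e_def by (cases "s = 0") auto
        ultimately show ?thesis using pos[of y] by blast
      qed
      moreover have "F n \<subseteq> K" by (auto simp only: F_def)
      ultimately show ?thesis by blast
    qed
    ultimately show ?thesis using K by (simp add: closedin_diff)
  qed
  moreover have "F n \<noteq> {}" for n
    using contr unfolding F_def by blast
  moreover have "decseq F"
  proof (rule decseq_SucI)
    fix n
    have le: "(1/2) ^ (Suc n + n0) \<le> (1/2 :: real) ^ (n + n0)" by (intro power_decreasing) auto
    show "F (Suc n) \<subseteq> F n"
    proof
      fix y assume "y \<in> F (Suc n)"
      then have y: "y \<in> K" "\<bar>tt y - s\<bar> \<le> (1/2) ^ (Suc n + n0)" "s = 0 \<or> (\<forall>k<Suc n + n0. cc y k = c k)"
        unfolding F_def by blast+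
      have "\<bar>tt y - s\<bar> \<le> (1/2) ^ (n + n0)"
        using y(2) le by (rule order_trans)
      then show "y \<in> F n" using y(1,3) by (auto simp: F_def)
    qed
  qed
  ultimately obtain y where y: "\<And>n. y \<in> F n"
    using compact_space_imp_nest[OF compact_X, of F] by blast
  have "tt y = s"
  proof (rule ccontr)
    assume "tt y \<noteq> s"
    then obtain n where "(1/2) ^ n < \<bar>tt y - s\<bar>"
      using real_arch_pow_inv[of "\<bar>tt y - s\<bar>" "1/2"] by auto
    moreover have "(1/2) ^ (n + n0) \<le> (1/2 :: real) ^ n" by (intro power_decreasing) auto
    moreover have "\<bar>tt y - s\<bar> \<le> (1/2) ^ (n + n0)" using y[of n] by (simp add: F_def)
    ultimately show False by linarith
  qed
  moreover have "y \<in> K" using y by (auto simp: F_def)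
  moreover have "cc y k = c k" if "s \<noteq> 0" for k
    using y[of "Suc k"] that by (simp add: F_def)
  ultimately show False using miss[of y] by blast
qed

lemma nbhd_base:
  assumes V: "openin X V" and x: "x \<in> V"
  shows "\<exists>n. \<forall>y\<in>topspace X. \<bar>tt y - tt x\<bar> \<le> (1/2) ^ n \<and> (tt x = 0 \<or> (\<forall>k<n. cc y k = cc x k)) \<longrightarrow> y \<in> V"
proof -
  have xX: "x \<in> topspace X" using V x openin_subset by blast
  have K: "closedin X (topspace X - V)" using V by blast
  have "\<exists>n. \<forall>y\<in>topspace X - V. \<not> (\<bar>tt y - tt x\<bar> \<le> (1/2) ^ n \<and> (tt x = 0 \<or> (\<forall>k<n. cc y k = cc x k)))"
  proof (rule closed_misses_nbhd[OF K])
    fix y assume "y \<in> topspace X - V" "tt y = tt x"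
    then show "tt x \<noteq> 0 \<and> cc y \<noteq> cc x" using coordinates_inj[of y x] x xX by auto
  qed (use tt_range xX in auto)
  then show ?thesis by blast
qed

lemma t0_space: "t0_space X"
  unfolding t0_space_def
proof (intro ballI impI)
  fix x y assume xy: "x \<in> topspace X" "y \<in> topspace X" "x \<noteq> y"
  show "\<exists>U. openin X U \<and> (x \<notin> U) = (y \<in> U)"
  proof (cases "tt x = tt y")
    case False
    then show ?thesis
      using xy open_lt[of "max (tt x) (tt y)"]
      by (intro exI[of _ "{z \<in> topspace X. tt z < max (tt x) (tt y)}"]) auto
  next
    case True
    then have "tt x \<noteq> 0" "cc x \<noteq> cc y" using coordinates_inj xy by blast+
    then obtain k where "cc x k \<noteq> cc y k" by blast
    moreover have "tt x > 0" using \<open>tt x \<noteq> 0\<close> tt_range xy by force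
    ultimately show ?thesis
      using xy True open_bit[of k True]
      by (intro exI[of _ "{z \<in> topspace X. tt z > 0 \<and> cc z k = True}"]) auto
  qed
qed

end

section \<open>Spoke lengths and tiles\<close>

locale comb = fan_coordinates X cc tt for X :: "'a topology" and cc tt +
  assumes down: "x \<in> topspace X \<Longrightarrow> 0 \<le> s \<Longrightarrow> s \<le> tt x \<Longrightarrow> \<exists>y\<in>topspace X. tt y = s \<and> (s = 0 \<or> cc y = cc x)"
    and three_spokes: "\<exists>x y z. {x, y, z} \<subseteq> topspace X \<and> tt x > 0 \<and> tt y > 0 \<and> tt z > 0 \<and>
      cc x \<noteq> cc y \<and> cc x \<noteq> cc z \<and> cc y \<noteq> cc z"
begin

text \<open>The case \<open>j = 0\<close> makes the maximum meaningful for prefixes that carry no point.\<close>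

definition len :: "nat \<Rightarrow> nat \<Rightarrow> nat" where
  "len k a = Max {j. j = 0 \<or> (\<exists>x\<in>topspace X. prefix_code k (cc x) = a \<and> tt x = real j / 2 ^ k)}"

text \<open>By \<open>down\<close>, the attained grid heights form an initial segment, bounded by
  \<open>2 ^ k\<close>, so their maximum determines them.\<close>

lemma le_len_iff:
  "j \<le> len k a \<longleftrightarrow> j = 0 \<or> (\<exists>x\<in>topspace X. prefix_code k (cc x) = a \<and> tt x = real j / 2 ^ k)"
proof -
  let ?J = "{j. j = 0 \<or> (\<exists>x\<in>topspace X. prefix_code k (cc x) = a \<and> tt x = real j / 2 ^ k)}"
  have "?J \<subseteq> {..2 ^ k}"
  proof
    fix j assume "j \<in> ?J"
    then consider "j = 0" | x where "x \<in> topspace X" "tt x = j / 2 ^ k" by blast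
    then show "j \<in> {..2 ^ k}"
    proof cases
      case (2 x)
      then have "real j / 2 ^ k \<le> 1" using tt_range[of x] by simp
      then have "real j \<le> real (2 ^ k)" by simp
      then show ?thesis unfolding of_nat_le_iff by simp
    qed simp
  qed
  then have fin: "finite ?J" using finite_subset by blast
  have "i \<in> ?J" if ij: "j \<in> ?J" "i \<le> j" for i j
  proof (cases "i = 0")
    case False
    then obtain x where x: "x \<in> topspace X" "prefix_code k (cc x) = a" "tt x = j / 2 ^ k"
      using ij by auto
    then have "i / 2 ^ k \<le> tt x" using ij(2) by (simp add: divide_right_mono)
    from down[OF x(1) _ this] obtain y where "y \<in> topspace X" "tt y = i / 2 ^ k" "cc y = cc x"
      using False by auto
    then show ?thesis using x by auto
  qed simp
  moreover have "len k a \<in> ?J" unfolding len_def using fin by (intro Max_in) auto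
  ultimately have "j \<le> len k a \<longleftrightarrow> j \<in> ?J"
    using Max_ge[OF fin, of j] by (auto simp: len_def[symmetric])
  then show ?thesis by simp
qed

lemma floor_le_len:
  assumes "x \<in> topspace X"
  shows "nat \<lfloor>2 ^ k * tt x\<rfloor> \<le> len k (prefix_code k (cc x))"
proof -
  have t: "0 \<le> tt x" using tt_range assms by blast
  then have "real (nat \<lfloor>2 ^ k * tt x\<rfloor>) \<le> 2 ^ k * tt x" by simp
  then have "nat \<lfloor>2 ^ k * tt x\<rfloor> / 2 ^ k \<le> tt x" by (simp add: field_simps)
  from down[OF assms _ this] obtain y where "y \<in> topspace X" "tt y = nat \<lfloor>2 ^ k * tt x\<rfloor> / 2 ^ k"
    "nat \<lfloor>2 ^ k * tt x\<rfloor> = 0 \<or> cc y = cc x" by auto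
  then show ?thesis by (auto simp: le_len_iff)
qed

lemma len_pos_code: "len k a > 0 \<Longrightarrow> a < 2 ^ k"
  using le_len_iff[of 1 k a] prefix_code_less by (auto simp: Suc_le_eq)

lemma len_pos_prefix:
  assumes "x \<in> topspace X" "(1/2) ^ k \<le> tt x"
  shows "len k (prefix_code k (cc x)) > 0"
proof -
  have "1 \<le> 2 ^ k * tt x" using assms(2) by (simp add: field_simps)
  then have "1 \<le> nat \<lfloor>2 ^ k * tt x\<rfloor>" by (simp add: le_nat_iff le_floor_iff)
  then show ?thesis using floor_le_len[OF assms(1), of k] by linarith
qed

lemma ex_fan_lengths: "\<exists>n0. \<forall>k\<ge>n0. fan_lengths (len k)"
proof -
  obtain x y z where xyz: "x \<in> topspace X" "y \<in> topspace X" "z \<in> topspace X" "tt x > 0" "tt y > 0" "tt z > 0"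
      "cc x \<noteq> cc y" "cc x \<noteq> cc z" "cc y \<noteq> cc z"
    using three_spokes by auto
  obtain a b c where "cc x a \<noteq> cc y a" "cc x b \<noteq> cc z b" "cc y c \<noteq> cc z c"
    using xyz by blast
  have half: "\<exists>d. (1/2) ^ d < t" if "t > 0" for t :: real
    using real_arch_pow_inv[OF that, of "1/2"] by auto
  obtain d e f where def: "(1/2) ^ d < tt x" "(1/2) ^ e < tt y" "(1/2) ^ f < tt z"
    using half xyz by meson
  \<comment> \<open>From \<open>n0\<close> on, the prefixes include the bits that tell the three
    addresses apart, hence the successors, and the grid is fine enough for each of the three points
    to reach grid height 1.\<close>
  define n0 where "n0 = Max {Suc a, Suc b, Suc c, d, e, f}"
  have n0: "a < n0" "b < n0" "c < n0" "d \<le> n0" "e \<le> n0" "f \<le> n0"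
    by (auto simp: n0_def Suc_le_eq[symmetric])
  have "fan_lengths (len k)" if k: "k \<ge> n0" for k
  proof -
    let ?A = "{prefix_code k (cc x), prefix_code k (cc y), prefix_code k (cc z)}"
    have fin: "finite {a. len k a > 0}"
      using len_pos_code by (intro finite_subset[OF _ finite_lessThan[of "2 ^ k"]]) blast
    have "(1/2) ^ k \<le> (1/2 :: real) ^ d" "(1/2) ^ k \<le> (1/2 :: real) ^ e" "(1/2) ^ k \<le> (1/2 :: real) ^ f"
      using n0 k by (auto intro!: power_decreasing)
    then have "(1/2) ^ k \<le> tt x" "(1/2) ^ k \<le> tt y" "(1/2) ^ k \<le> tt z"
      using def by linarith+
    then have "?A \<subseteq> {a. len k a > 0}"
      using len_pos_prefix[of x k] len_pos_prefix[of y k] len_pos_prefix[of z k] xyz def by simp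
    moreover have "card ?A = 3"
    proof -
      have "prefix_code k (cc x) \<noteq> prefix_code k (cc y)" "prefix_code k (cc x) \<noteq> prefix_code k (cc z)"
        "prefix_code k (cc y) \<noteq> prefix_code k (cc z)"
        using \<open>cc x a \<noteq> cc y a\<close> \<open>cc x b \<noteq> cc z b\<close> \<open>cc y c \<noteq> cc z c\<close> n0(1-3) k less_le_trans
        unfolding prefix_code_eq_iff by blast+
      then show ?thesis by simp
    qed
    ultimately have "3 \<le> card {a. len k a > 0}" using card_mono[OF fin] by metis
    with fin show ?thesis by (simp add: fan_lengths_def)
  qed
  then show ?thesis by blast
qed

lemma fan_refinement_len:
  assumes "fan_lengths (len k)" "fan_lengths (len (Suc k))"
  shows "fan_refinement (len k) (len (Suc k))"
proof
  fix a j assume j: "j \<le> len (Suc k) a"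
  show "j div 2 \<le> len k (a div 2)"
  proof (cases "j div 2 = 0")
    case False
    then obtain x where x: "x \<in> topspace X" "prefix_code (Suc k) (cc x) = a" "tt x = j / 2 ^ Suc k"
      using j by (auto simp: le_len_iff simp del: prefix_code.simps)
    have "real (j div 2) \<le> real j / 2" using of_nat_div_le_of_nat[of j 2] by simp
    then have "(j div 2) / 2 ^ k \<le> tt x" using x(3) by (simp add: field_simps)
    from down[OF x(1) _ this] obtain y where "y \<in> topspace X" "tt y = (j div 2) / 2 ^ k" "cc y = cc x"
      using False by auto
    moreover have "prefix_code k (cc x) = a div 2" using x(2) prefix_code_Suc_div by metis
    ultimately show ?thesis by (auto simp: le_len_iff)
  qed simp
next
  fix a i assume "0 < i" "i \<le> len k a"
  then obtain x where x: "x \<in> topspace X" "prefix_code k (cc x) = a" "tt x = i / 2 ^ k"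
    by (auto simp: le_len_iff)
  \<comment> \<open>On the finer grid the same point has height \<open>2 * i\<close>, and its next
    bit selects \<open>a'\<close>.\<close>
  then have "prefix_code (Suc k) (cc x) div 2 = a" "2 * i \<le> len (Suc k) (prefix_code (Suc k) (cc x))"
    by (auto simp: le_len_iff simp del: prefix_code.simps intro: bexI[of _ x] simp: prefix_code_Suc_div)
  then show "\<exists>a'. a' div 2 = a \<and> 2 * i \<le> len (Suc k) a'" by blast
qed (fact assms)+

text \<open>The floor makes tiles closed at the bottom and open at the top. At height 0
  \<open>vtx\<close> ignores the column, so the lowest tiles of all spokes merge into one, and the
  arbitrary address of the root does no harm.\<close>

definition tile :: "nat \<Rightarrow> 'a \<Rightarrow> nat" where
  "tile k x = vtx (prefix_code k (cc x)) (nat \<lfloor>2 ^ k * tt x\<rfloor>)"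

lemma tile_in_fan_verts: "x \<in> topspace X \<Longrightarrow> tile k x \<in> fan_verts (len k)"
  unfolding tile_def by (intro vtx_in_fan_verts floor_le_len)

lemma hgt_tile: "hgt (tile k x) = nat \<lfloor>2 ^ k * tt x\<rfloor>"
  by (simp add: tile_def)

lemma col_tile: "hgt (tile k x) > 0 \<Longrightarrow> col (tile k x) = prefix_code k (cc x)"
  by (simp add: tile_def col_vtx)

lemma tile_image: "tile k ` topspace X = fan_verts (len k)"
proof
  show "tile k ` topspace X \<subseteq> fan_verts (len k)" using tile_in_fan_verts by blast
  show "fan_verts (len k) \<subseteq> tile k ` topspace X"
  proof
    fix v assume "v \<in> fan_verts (len k)"
    then show "v \<in> tile k ` topspace X"
    proof (cases rule: fan_verts_cases)
      case 1
      obtain x where "x \<in> topspace X" "tt x > 0" using three_spokes by auto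
      then obtain y where "y \<in> topspace X" "tt y = 0" using down[of x 0] by auto
      then show ?thesis using 1 by (auto simp: tile_def intro!: image_eqI[of _ _ y])
    next
      case (2 a i)
      then obtain x where "x \<in> topspace X" "prefix_code k (cc x) = a" "tt x = i / 2 ^ k"
        by (auto simp: le_len_iff)
      then show ?thesis using 2 by (auto simp: tile_def intro!: image_eqI[of _ _ x])
    qed
  qed
qed

lemma tile_step:
  assumes x: "x \<in> topspace X"
  shows "(tile k x, tile (Suc k) x) \<in> refinement (len k) (len (Suc k))"
proof -
  have "\<lfloor>2 ^ Suc k * tt x\<rfloor> div 2 = \<lfloor>2 ^ k * tt x\<rfloor>"
    using floor_divide_real_eq_div[of 2 "2 ^ Suc k * tt x"] by simp
  then have "hgt (tile k x) = hgt (tile (Suc k) x) div 2"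
    unfolding hgt_tile by (metis nat_div_distrib' nat_numeral zero_le_numeral)
  moreover then have "hgt (tile k x) = 0 \<or> col (tile k x) = col (tile (Suc k) x) div 2"
    using col_tile[of k x] col_tile[of "Suc k" x] prefix_code_Suc_div[of k "cc x"] by (metis div_0 gr0I)
  ultimately show ?thesis
    using tile_in_fan_verts[OF x] by (auto simp: refinement_def)
qed

text \<open>The ceiling provides the open neighbourhood: points in the half tile just below height
  \<open>i\<close> have height \<open>2 * i - 1\<close> on level \<open>k + 1\<close>, whose ceiling
  is \<open>i\<close>. With floors alone, a point on the lower edge of a non-root tile would have no
  such neighbourhood.\<close>

lemma tile_step_nbhd:
  assumes x: "x \<in> topspace X"
  shows "\<exists>W. openin X W \<and> x \<in> W \<and> (\<forall>z\<in>W. (tile k x, tile (Suc k) z) \<in> refinement (len k) (len (Suc k)))"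
proof -
  define i where "i = nat \<lfloor>2 ^ k * tt x\<rfloor>"
  have t: "0 \<le> tt x" using tt_range x by blast
  then have "0 \<le> 2 ^ k * tt x" by simp
  then have i: "real i \<le> 2 ^ k * tt x" "2 ^ k * tt x < real i + 1" unfolding i_def by linarith+
  have key: "(tile k x, tile (Suc k) z) \<in> refinement (len k) (len (Suc k))"
    if z: "z \<in> topspace X" "2 ^ k * tt z > i - 1/2" "2 ^ k * tt z < i + 1"
      "i = 0 \<or> prefix_code (Suc k) (cc z) = prefix_code (Suc k) (cc x)" for z
  proof -
    define j where "j = nat \<lfloor>2 ^ Suc k * tt z\<rfloor>"
    have "0 \<le> tt z" using tt_range z by blast
    then have "0 \<le> 2 ^ Suc k * tt z" by simp
    then have "real j \<le> 2 ^ Suc k * tt z" "2 ^ Suc k * tt z < real j + 1" unfolding j_def by linarith+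
    then have "real j < 2 * real i + 2" "2 * real i < real j + 2" using z by simp_all
    then have "j < 2 * i + 2" "2 * i < j + 2" by linarith+
    \<comment> \<open>Only \<open>2 * i - 1\<close>, \<open>2 * i\<close> and
      \<open>2 * i + 1\<close> are possible, and each of them rounds to \<open>i\<close> in some
      direction.\<close>
    then have ij: "i = j div 2 \<or> i = Suc j div 2" by presburger
    have h: "hgt (tile k x) = i" "hgt (tile (Suc k) z) = j"
      by (simp_all only: hgt_tile i_def j_def)
    have "i = 0 \<or> col (tile k x) = col (tile (Suc k) z) div 2"
    proof (cases "i = 0")
      case False
      then have "j > 0" using ij by (cases j) auto
      then show ?thesis
        using False h col_tile[of k x] col_tile[of "Suc k" z] z(4) prefix_code_Suc_div[of k "cc x"] by simp
    qed simp
    then show ?thesis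
      using ij h tile_in_fan_verts[OF x, of k] tile_in_fan_verts[OF z(1), of "Suc k"]
      by (simp add: refinement_def)
  qed
  \<comment> \<open>The window extends half a tile below the tile of \<open>x\<close>. For the root
    tile no address may be prescribed, since all spokes meet there.\<close>
  define W where "W = {z \<in> topspace X. tt z > (i - 1/2) / 2 ^ k} \<inter> {z \<in> topspace X. tt z < (i + 1) / 2 ^ k} \<inter>
      (if i = 0 then topspace X else {z \<in> topspace X. tt z > 0 \<and> (\<forall>l<Suc k. cc z l = cc x l)})"
  have "openin X W"
    unfolding W_def using open_gt open_lt open_agree by (auto intro!: openin_Int)
  moreover have "x \<in> W"
  proof -
    have "tt x > 0" if "i > 0"
      using that i(1) t by (cases "tt x = 0") auto
    then show ?thesis
      using x t i by (auto simp: W_def field_simps)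
  qed
  moreover have "(tile k x, tile (Suc k) z) \<in> refinement (len k) (len (Suc k))" if "z \<in> W" for z
  proof (rule key)
    show "z \<in> topspace X" using that by (simp add: W_def)
    show "2 ^ k * tt z > i - 1/2" "2 ^ k * tt z < i + 1"
      using that by (auto simp: W_def field_simps)
    show "i = 0 \<or> prefix_code (Suc k) (cc z) = prefix_code (Suc k) (cc x)"
      unfolding prefix_code_eq_iff using that by (auto simp: W_def split: if_splits)
  qed
  ultimately show ?thesis by blast
qed

end

section \<open>The sequence of levels and its tiling\<close>

context comb
begin

text \<open>On coarse levels short spokes vanish and spokes with a common prefix merge, so fewer
  than three may remain; the sequence starts where all further levels are fans.\<close>

definition start :: nat where
  "start = (SOME n0. \<forall>k\<ge>n0. fan_lengths (len k))"

lemma fan_lengths_len: "start \<le> k \<Longrightarrow> fan_lengths (len k)"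
  using someI_ex[OF ex_fan_lengths] unfolding start_def by blast

definition level :: "nat \<Rightarrow> nat graph" where
  "level n = coded_fan (len (start + n))"

definition step :: "nat \<Rightarrow> (nat \<times> nat) set" where
  "step n = refinement (len (start + n)) (len (Suc (start + n)))"

lemma fan_refinement_level: "fan_refinement (len (start + n)) (len (Suc (start + n)))"
  by (intro fan_refinement_len fan_lengths_len) auto

lemma step_subset: "step n \<subseteq> verts (level n) \<times> verts (level (Suc n))"
  by (auto simp: step_def level_def refinement_def)

lemma L_morphism_step: "L_morphism (level (Suc n)) (level n) (step n)"
  using fan_refinement.L_morphism_refinement[OF fan_refinement_level[of n]]
  by (simp add: step_def level_def)

lemma graph_fan_level: "graph_fan (level n)"
  unfolding level_def by (intro graph_fan_coded_fan fan_lengths_len) simp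

lemma graph_sequence_L: "graph_sequence L_morphism level (bonding level step)"
  by (intro graph_sequence_bonding L_morphism_step L_morphism_Id graph_fan_level step_subset)
    (rule L_morphism_comp)

lemma bonding_step: "bonding level step n (Suc n) = step n"
  using step_subset[of n] by (auto simp: bonding_Suc bonding_refl)

text \<open>One step moves the real height of a vertex by at most one unit of the finer grid, which
  equals the difference of the two grid units. The errors therefore telescope and stay below one
  unit of level \<open>m\<close>, however far apart the levels are.\<close>

lemma bonding_bounds:
  assumes "m \<le> n" "(u, v) \<in> bonding level step m n"
  shows "\<bar>hgt v / 2 ^ (start + n) - hgt u / 2 ^ (start + m)\<bar> \<le> 1 / 2 ^ (start + m) - 1 / 2 ^ (start + n) \<and>
    (hgt u = 0 \<or> hgt v > 0 \<and> col u = col v div 2 ^ (n - m))"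
  using assms
proof (induction n arbitrary: v rule: dec_induct)
  case base
  then show ?case by (auto simp: bonding_refl)
next
  case (step n)
  then obtain w where w: "(u, w) \<in> bonding level step m n" "(w, v) \<in> step n"
    by (auto simp: bonding_Suc)
  define K :: real where "K = 2 ^ (start + n)"
  have K: "K > 0" "2 ^ (start + Suc n) = 2 * K" by (simp_all add: K_def)
  have hw: "hgt w = hgt v div 2 \<or> hgt w = Suc (hgt v) div 2" "hgt w = 0 \<or> col w = col v div 2"
    using w(2) by (auto simp: step_def refinement_def)
  then have "2 * hgt w \<le> hgt v + 1" "hgt v \<le> 2 * hgt w + 1" by auto
  then have "real (2 * hgt w) \<le> real (hgt v + 1)" "real (hgt v) \<le> real (2 * hgt w + 1)"
    unfolding of_nat_le_iff .
  then have "\<bar>(real (hgt v) - 2 * real (hgt w)) / (2 * K)\<bar> \<le> 1 / (2 * K)"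
    using K by (simp add: abs_le_iff divide_right_mono field_simps)
  moreover have "(real (hgt v) - 2 * real (hgt w)) / (2 * K) = hgt v / (2 * K) - hgt w / K"
    using K by (simp add: field_simps)
  moreover have "\<bar>hgt w / K - hgt u / 2 ^ (start + m)\<bar> \<le> 1 / 2 ^ (start + m) - 1 / K"
    using step.IH[OF w(1)] by (simp add: K_def)
  moreover have "1 / K = 1 / (2 * K) + 1 / (2 * K)" by simp
  ultimately have "\<bar>hgt v / (2 * K) - hgt u / 2 ^ (start + m)\<bar> \<le> 1 / 2 ^ (start + m) - 1 / (2 * K)"
    by linarith
  moreover have "hgt u = 0 \<or> hgt v > 0 \<and> col u = col v div 2 ^ (Suc n - m)"
  proof (cases "hgt u = 0")
    case False
    then have "hgt w > 0" "col u = col w div 2 ^ (n - m)" using step.IH[OF w(1)] by auto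
    moreover from this have "hgt v > 0" "col w = col v div 2" using hw by (cases "hgt v"; auto)+
    ultimately show ?thesis using step.hyps by (simp add: Suc_diff_le div_mult2_eq)
  qed simp
  ultimately show ?case unfolding K(2) by blast
qed

lemma tile_bounds:
  assumes z: "z \<in> topspace X" and le: "m \<le> n" and q: "(q, tile (start + n) z) \<in> bonding level step m n"
  shows "\<bar>tt z - hgt q / 2 ^ (start + m)\<bar> \<le> 2 / 2 ^ (start + m)"
    "hgt q = 0 \<or> col q = prefix_code (start + m) (cc z)"
proof -
  define j where "j = hgt (tile (start + n) z)"
  define K :: real where "K = 2 ^ (start + n)"
  have K: "K > 0" by (simp add: K_def)
  note b = bonding_bounds[OF le q]
  have "0 \<le> K * tt z" using tt_range[OF z] K by simp
  then have "real j \<le> K * tt z" "K * tt z \<le> real j + 1"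
    unfolding j_def hgt_tile K_def by linarith+
  then have "\<bar>(K * tt z - j) / K\<bar> \<le> 1 / K"
    using K by (simp add: abs_le_iff divide_right_mono)
  moreover have "(K * tt z - j) / K = tt z - j / K"
    using K by (simp add: field_simps)
  ultimately have "\<bar>tt z - j / K\<bar> \<le> 1 / K" by simp
  \<comment> \<open>The width \<open>1 / K\<close> of the tile cancels against the last term of this
    telescoped bound.\<close>
  moreover have "\<bar>j / K - hgt q / 2 ^ (start + m)\<bar> \<le> 1 / 2 ^ (start + m) - 1 / K"
    using b by (simp add: j_def K_def)
  moreover have "1 / (2::real) ^ (start + m) \<ge> 0" by simp
  moreover have "(2::real) / 2 ^ (start + m) = 1 / 2 ^ (start + m) + 1 / 2 ^ (start + m)" by simp
  ultimately show "\<bar>tt z - hgt q / 2 ^ (start + m)\<bar> \<le> 2 / 2 ^ (start + m)" by linarith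
  show "hgt q = 0 \<or> col q = prefix_code (start + m) (cc z)"
    using b col_tile[of "start + n" z] prefix_code_div[of "start + m" "start + n" "cc z"] le by auto
qed

lemma tile_bonding:
  assumes "m \<le> n" "x \<in> topspace X"
  shows "(tile (start + m) x, tile (start + n) x) \<in> bonding level step m n"
  using assms(1)
proof (induction n rule: dec_induct)
  case base
  then show ?case using tile_in_fan_verts[OF assms(2)] by (auto simp: bonding_refl level_def)
next
  case (step n)
  then show ?case
    using tile_step[OF assms(2), of "start + n"] by (auto simp: bonding_Suc step_def)
qed

lemma tile_small:
  assumes V: "openin X V" and x: "x \<in> V"
  shows "\<exists>n\<ge>k. \<exists>W. openin X W \<and> x \<in> W \<and>
    (\<forall>z\<in>W. \<forall>l\<ge>n. \<forall>q. (q, tile (start + l) z) \<in> bonding level step n l \<longrightarrow>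
      (\<forall>z'\<in>topspace X. \<forall>l'\<ge>n. (q, tile (start + l') z') \<in> bonding level step n l' \<longrightarrow> z' \<in> V))"
proof -
  have xX: "x \<in> topspace X" using V x openin_subset by blast
  obtain d where d: "\<And>y. y \<in> topspace X \<Longrightarrow> \<bar>tt y - tt x\<bar> \<le> (1/2) ^ d \<Longrightarrow>
      tt x = 0 \<or> (\<forall>k<d. cc y k = cc x k) \<Longrightarrow> y \<in> V"
    using nbhd_base[OF V x] by blast
  obtain d' :: nat where d': "tt x = 0 \<or> (1/2) ^ d' < tt x"
    using real_arch_pow_inv[of "tt x" "1/2"] tt_range[OF xX] by fastforce
  \<comment> \<open>With \<open>e\<close> the grid unit of level \<open>n\<close>, passing from
    \<open>x\<close> to \<open>z\<close> costs at most \<open>e\<close>, and from \<open>z\<close>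
    to \<open>q\<close> and from \<open>q\<close> to \<open>z'\<close> at most \<open>2 * e\<close>
    each, so \<open>8 * e\<close> is enough for the heights. The bound \<open>4 * e < tt x\<close>
    keeps \<open>q\<close> off the root, where its column is meaningless. The summands 3 and 2 are
    the exponents of 8 and 4, and \<open>n \<ge> d\<close> makes the shared prefix long
    enough.\<close>
  define n where "n = Max {k, d + 3, d' + 2}"
  have n: "n \<ge> k" "n \<ge> d + 3" "n \<ge> d' + 2" by (auto simp: n_def)
  define e :: real where "e = 1 / 2 ^ (start + n)"
  have "e = (1/2) ^ (start + n)" by (simp add: e_def power_one_over)
  also have "\<dots> \<le> (1/2) ^ (d + 3)" using n by (intro power_decreasing) auto
  finally have e1: "8 * e \<le> (1/2) ^ d" by (simp add: power_add power3_eq_cube power2_eq_square)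
  have "e = (1/2) ^ (start + n)" by (simp add: e_def power_one_over)
  also have "\<dots> \<le> (1/2) ^ (d' + 2)" using n by (intro power_decreasing) auto
  finally have e2: "4 * e \<le> (1/2) ^ d'" by (simp add: power_add power3_eq_cube power2_eq_square)
  have e0: "e > 0" by (simp add: e_def)
  define W where "W = {z \<in> topspace X. tt z > tt x - e} \<inter> {z \<in> topspace X. tt z < tt x + e} \<inter>
    (if tt x = 0 then topspace X else {z \<in> topspace X. tt z > 0 \<and> (\<forall>l<d. cc z l = cc x l)})"
  have W: "openin X W"
    unfolding W_def using open_gt open_lt open_agree by (auto intro!: openin_Int)
  have xW: "x \<in> W"
    using xX e0 tt_range[OF xX] by (auto simp: W_def)
  have key: "z' \<in> V" if z: "z \<in> W" and l: "l \<ge> n" "(q, tile (start + l) z) \<in> bonding level step n l"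
    and z': "z' \<in> topspace X" and l': "l' \<ge> n" "(q, tile (start + l') z') \<in> bonding level step n l'"
    for z l q z' l'
  proof -
    have zX: "z \<in> topspace X" using z by (simp add: W_def)
    have tz: "\<bar>tt z - tt x\<bar> < e" using z by (auto simp: W_def)
    note b = tile_bounds[OF zX l] and b' = tile_bounds[OF z' l']
    have two: "2 / 2 ^ (start + n) = 2 * e" by (simp add: e_def)
    have close: "\<bar>tt z - hgt q / 2 ^ (start + n)\<bar> \<le> 2 * e" "\<bar>tt z' - hgt q / 2 ^ (start + n)\<bar> \<le> 2 * e"
      using b(1) b'(1) unfolding two .
    have "\<bar>tt z' - tt x\<bar> \<le> (1/2) ^ d" using close tz e1 e0 by linarith
    moreover have "tt x = 0 \<or> (\<forall>k<d. cc z' k = cc x k)"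
    proof (cases "tt x = 0")
      case False
      then have "tt x > 4 * e" using d' e2 by linarith
      then have "tt z > 2 * e" using tz by linarith
      then have "hgt q \<noteq> 0" using close(1) by (intro notI) simp
      then have "prefix_code (start + n) (cc z) = prefix_code (start + n) (cc z')"
        using b(2) b'(2) by simp
      then have "\<forall>k<d. cc z k = cc z' k"
        using n by (simp add: prefix_code_eq_iff)
      then show ?thesis using z False by (simp add: W_def)
    qed simp
    ultimately show ?thesis using d z' by blast
  qed
  show ?thesis
    using n(1) W xW key by blast
qed

lemma tiled_space_level: "tiled_space level (bonding level step) X (\<lambda>n. tile (start + n))"
proof (unfold_locales)
  show "graph_sequence L_morphism level (bonding level step)" by (rule graph_sequence_L)
  show "compact_space X" by (rule compact_X)
  show "t0_space X" by (rule t0_space)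
  show "tile (start + n) ` topspace X = verts (level n)" for n
    by (simp add: tile_image level_def)
  show "(tile (start + m) x, tile (start + n) x) \<in> bonding level step m n"
    if "m \<le> n" "x \<in> topspace X" for m n x
    using tile_bonding that by blast
  show "\<exists>n\<ge>m. \<exists>W. openin X W \<and> x \<in> W \<and>
      (\<forall>z\<in>W. (tile (start + m) x, tile (start + n) z) \<in> bonding level step m n)"
    if "x \<in> topspace X" for m x
    using tile_step_nbhd[OF that, of "start + m"]
    by (intro exI[of _ "Suc m"]) (simp add: bonding_step step_def)
qed (rule tile_small)

lemma homeomorphic_spectrum: "X homeomorphic_space sequence_spectrum level (bonding level step)"
  using tiled_space.homeomorphic_sequence_spectrum[OF tiled_space_level] .

lemma graph_sequence_X:
  assumes full: "\<And>c. \<exists>x\<in>topspace X. cc x = c \<and> tt x = 1"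
  shows "graph_sequence X_morphism level (bonding level step)"
proof -
  \<comment> \<open>Full spokes reach every grid height, so every group has length
    \<open>2 ^ k\<close> and lengths double exactly.\<close>
  have len: "len k a = (if a < 2 ^ k then 2 ^ k else 0)" for k a
  proof (cases "a < 2 ^ k")
    case True
    then obtain c where c: "prefix_code k c = a" using prefix_code_surj by blast
    obtain x where x: "x \<in> topspace X" "cc x = c" "tt x = 1" using full by blast
    then have "2 ^ k \<le> len k a" using c by (auto simp: le_len_iff intro!: bexI[of _ x])
    moreover have "len k a \<le> 2 ^ k"
    proof (cases "len k a = 0")
      case False
      then obtain y where "y \<in> topspace X" "tt y = len k a / 2 ^ k"
        using le_len_iff[of "len k a" k a] by auto
      then have "real (len k a) / 2 ^ k \<le> 1" using tt_range[of y] by simp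
      then have "real (len k a) \<le> real (2 ^ k)" by simp
      then show ?thesis unfolding of_nat_le_iff .
    qed simp
    ultimately show ?thesis using True by simp
  next
    case False
    then show ?thesis using len_pos_code[of k a] by auto
  qed
  have "X_morphism (level (Suc n)) (level n) (step n)" for n
  proof -
    have "len (Suc (start + n)) a = 2 * len (start + n) (a div 2)" for a
      unfolding len by auto
    from fan_refinement.X_morphism_refinement[OF fan_refinement_level[of n] this]
    show ?thesis by (simp add: step_def level_def)
  qed
  then show ?thesis
    by (rule graph_sequence_bonding) (auto intro: X_morphism_Id graph_fan_level X_morphism_comp dest: step_subset[THEN subsetD])
qed

end

section \<open>Ramification points and maps to the line\<close>

lemma embedding_map_imp_continuous_map: "embedding_map X Y f \<Longrightarrow> continuous_map X Y f"
  unfolding embedding_map_def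
  using continuous_map_into_fulltopology homeomorphic_imp_continuous_map by blast

lemma embedding_imp_injective_map: "embedding_map X Y f \<Longrightarrow> inj_on f (topspace X)"
  unfolding embedding_map_def by (rule homeomorphic_imp_injective_map)

text \<open>By the intermediate value theorem both arcs attain the smaller end value
  \<open>y\<close>, and injectivity of \<open>g\<close> identifies the two points; their value
  exceeds \<open>g x\<close>, so the arcs share a point other than \<open>x\<close>.\<close>

lemma arcs_on_one_side_meet:
  fixes g :: "'a \<Rightarrow> real"
  assumes g: "continuous_map X euclideanreal g" "inj_on g (topspace X)"
    and A: "arc_between X x a A" and B: "arc_between X x b B" and "A \<inter> B = {x}"
    and a: "g x < g a" and b: "g x < g b"
  shows False
proof -
  define y where "y = min (g a) (g b)"
  have *: "\<exists>z\<in>A. z \<in> topspace X \<and> g z = y" if A: "arc_between X x a A" and y: "g x \<le> y" "y \<le> g a" for a A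
  proof -
    obtain f where f: "embedding_map (top_of_set {0..1::real}) X f" "f 0 = x" "f 1 = a" "A = f ` {0..1}"
      using A unfolding arc_between_def by blast
    then have cf: "continuous_map (top_of_set {0..1}) X f"
      by (simp add: embedding_map_imp_continuous_map)
    then have "continuous_on {0..1} (g \<circ> f)"
      using continuous_map_compose[OF cf g(1)] by simp
    then obtain s where "0 \<le> s" "s \<le> 1" "(g \<circ> f) s = y"
      using IVT'[of "g \<circ> f" 0 y 1] y f by auto
    moreover then have "f s \<in> topspace X"
      using cf by (auto simp: continuous_map_def)
    ultimately show ?thesis using f by auto
  qed
  obtain z where z: "z \<in> A" "z \<in> topspace X" "g z = y" using *[OF A] a b by (force simp: y_def)
  obtain w where w: "w \<in> B" "w \<in> topspace X" "g w = y" using *[OF B] a b by (force simp: y_def)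
  have "z = w" using g(2) z w by (simp add: inj_on_def)
  then have "z = x" using z w \<open>A \<inter> B = {x}\<close> by auto
  then show False using z a b by (simp add: y_def min_def split: if_splits)
qed

text \<open>Each of the three arcs ends on one of the two sides of \<open>g x\<close>, so two of
  them end on the same side.\<close>

lemma no_ramification_point_in_line:
  fixes g :: "'a \<Rightarrow> real"
  assumes g: "continuous_map X euclideanreal g" "inj_on g (topspace X)"
  shows "\<not> ramification_point X x"
proof
  assume "ramification_point X x"
  then obtain A B C a b c where arcs: "arc_between X x a A" "arc_between X x b B" "arc_between X x c C"
    and disj: "A \<inter> B = {x}" "A \<inter> C = {x}" "B \<inter> C = {x}"
    unfolding ramification_point_def by blast
  have ne: "g a \<noteq> g x" if A: "arc_between X x a A" for a A
  proof -
    obtain f where f: "embedding_map (top_of_set {0..1::real}) X f" "f 0 = x" "f 1 = a"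
      using A unfolding arc_between_def by blast
    have "inj_on f {0..1}" using embedding_imp_injective_map[OF f(1)] by simp
    then have "x \<noteq> a" using f by (auto dest: inj_onD[of _ _ 0 1])
    moreover have "x \<in> topspace X" "a \<in> topspace X"
      using embedding_map_imp_continuous_map[OF f(1)] f by (auto simp: continuous_map_def)
    ultimately show ?thesis using g(2) by (auto dest: inj_onD)
  qed
  have h: "continuous_map X euclideanreal (\<lambda>z. - g z)" "inj_on (\<lambda>z. - g z) (topspace X)"
    using g by (auto simp: inj_on_def intro: continuous_map_minus)
  note up = arcs_on_one_side_meet[OF g] and down = arcs_on_one_side_meet[OF h]
  show False
    using ne[OF arcs(1)] ne[OF arcs(2)] ne[OF arcs(3)]
      up[OF arcs(1,2) disj(1)] up[OF arcs(1,3) disj(2)] up[OF arcs(2,3) disj(3)]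
      down[OF arcs(1,2) disj(1)] down[OF arcs(1,3) disj(2)] down[OF arcs(2,3) disj(3)]
    by linarith
qed

context fan_coordinates
begin

text \<open>With at most two spokes, the height, signed according to the spoke, maps the space
  continuously and injectively to the line.\<close>

lemma three_spokes_if_ramification:
  assumes "ramification_point X p"
  shows "\<exists>x y z. {x, y, z} \<subseteq> topspace X \<and> tt x > 0 \<and> tt y > 0 \<and> tt z > 0 \<and>
      cc x \<noteq> cc y \<and> cc x \<noteq> cc z \<and> cc y \<noteq> cc z"
proof (rule ccontr)
  assume contr: "\<not> ?thesis"
  have "\<exists>c d. \<forall>x\<in>topspace X. tt x > 0 \<longrightarrow> cc x = c \<or> cc x = d"
  proof (cases "\<exists>x\<in>topspace X. tt x > 0")
    case True
    then obtain x where x: "x \<in> topspace X" "tt x > 0" by blast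
    show ?thesis
    proof (cases "\<exists>y\<in>topspace X. tt y > 0 \<and> cc y \<noteq> cc x")
      case True
      then obtain y where y: "y \<in> topspace X" "tt y > 0" "cc y \<noteq> cc x" by blast
      have "cc z = cc x \<or> cc z = cc y" if "z \<in> topspace X" "tt z > 0" for z
        using contr x y that by (metis empty_subsetI insert_subset)
      then show ?thesis by blast
    qed blast
  qed blast
  then obtain c d where "\<forall>x\<in>topspace X. tt x > 0 \<longrightarrow> cc x = c \<or> cc x = d"
    by (elim exE)
  then have cd: "cc x = c \<or> cc x = d" if "x \<in> topspace X" "tt x > 0" for x
    using that by blast
  have "\<exists>k. c = d \<or> c k \<noteq> d k" by (auto simp: fun_eq_iff)
  then obtain k where k: "c = d \<or> c k \<noteq> d k" by (elim exE)
  \<comment> \<open>A single bit \<open>k\<close> separates the two addresses. At the root this bit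
    is arbitrary, but the value is 0 with either sign.\<close>
  define g where "g x = (if cc x k = c k then tt x else - tt x)" for x
  have "inj_on g (topspace X)"
  proof (rule inj_onI)
    fix x y assume xy: "x \<in> topspace X" "y \<in> topspace X" "g x = g y"
    then have t: "0 \<le> tt x" "0 \<le> tt y" using tt_range by blast+
    then have eq: "tt x = tt y" using xy(3) by (auto simp: g_def split: if_splits)
    show "x = y"
    proof (cases "tt x = 0")
      case False
      then have "cc x k = c k \<longleftrightarrow> cc y k = c k" using xy(3) eq t by (auto simp: g_def split: if_splits)
      moreover have "tt x > 0" "tt y > 0" using False eq t by simp_all
      ultimately have "cc x = cc y" using cd[OF xy(1)] cd[OF xy(2)] k by metis
      then show ?thesis using coordinates_inj xy eq by blast
    qed (use coordinates_inj xy eq in blast)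
  qed
  moreover have "continuous_map X euclideanreal g"
    unfolding continuous_map_upper_lower_semicontinuous_lt
  proof (intro conjI allI)
    fix u
    \<comment> \<open>For \<open>u < 0\<close> the set contains the root, where no bit is
      controlled; there all heights below \<open>- u\<close> qualify whatever the sign.\<close>
    have "{x \<in> topspace X. g x > u} = (if u \<ge> 0
        then {x \<in> topspace X. tt x > u} \<inter> {x \<in> topspace X. tt x > 0 \<and> cc x k = c k}
        else {x \<in> topspace X. tt x < - u} \<union> {x \<in> topspace X. tt x > 0 \<and> cc x k = c k})"
    proof -
      have "u < g x \<longleftrightarrow> (if u \<ge> 0 then u < tt x \<and> 0 < tt x \<and> cc x k = c k
          else tt x < - u \<or> 0 < tt x \<and> cc x k = c k)" if "x \<in> topspace X" for x
        using tt_range[OF that] by (cases "cc x k = c k"; cases "u \<ge> 0") (auto simp: g_def)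
      then show ?thesis by auto
    qed
    then show "openin X {x \<in> topspace X. g x > u}"
      using open_gt open_lt open_bit by (simp add: openin_Int openin_Un)
    have "{x \<in> topspace X. g x < u} = (if u \<le> 0
        then {x \<in> topspace X. tt x > - u} \<inter> {x \<in> topspace X. tt x > 0 \<and> cc x k = (\<not> c k)}
        else {x \<in> topspace X. tt x < u} \<union> {x \<in> topspace X. tt x > 0 \<and> cc x k = (\<not> c k)})"
    proof -
      have "g x < u \<longleftrightarrow> (if u \<le> 0 then - u < tt x \<and> 0 < tt x \<and> cc x k = (\<not> c k)
          else tt x < u \<or> 0 < tt x \<and> cc x k = (\<not> c k))" if "x \<in> topspace X" for x
        using tt_range[OF that] by (cases "cc x k = c k"; cases "u \<le> 0") (auto simp: g_def)
      then show ?thesis by auto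
    qed
    then show "openin X {x \<in> topspace X. g x < u}"
      using open_gt open_lt open_bit by (simp add: openin_Int openin_Un)
  qed
  ultimately show False
    using no_ramification_point_in_line[of X g p] assms by simp
qed

text \<open>Any gap would disconnect the space. Without a point of height 0, a bit on which two
  addresses differ would split it. If a spoke skipped the height \<open>s\<close>, then by
  compactness a whole cylinder of spokes would skip a neighbourhood of \<open>s\<close>, and the
  part of the cylinder above \<open>s\<close> would be open and closed.\<close>

lemma comb_if_connected:
  assumes conn: "connected_space X" and ram: "ramification_point X p"
  shows "comb X cc tt"
proof
  note three = three_spokes_if_ramification[OF ram]
  then show "\<exists>x y z. {x, y, z} \<subseteq> topspace X \<and> tt x > 0 \<and> tt y > 0 \<and> tt z > 0 \<and>
      cc x \<noteq> cc y \<and> cc x \<noteq> cc z \<and> cc y \<noteq> cc z" .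
  have sep: False if "openin X U" "openin X V" "topspace X \<subseteq> U \<union> V" "U \<inter> V = {}" "U \<noteq> {}" "V \<noteq> {}" for U V
    using conn that unfolding connected_space_def by blast
  have root: "\<exists>r\<in>topspace X. tt r = 0"
  proof (rule ccontr)
    assume "\<not> ?thesis"
    then have pos: "tt x > 0" if "x \<in> topspace X" for x
      using tt_range[OF that] that by force
    obtain x y where xy: "x \<in> topspace X" "y \<in> topspace X" "cc x \<noteq> cc y"
      using three by auto
    then obtain k where k: "cc x k \<noteq> cc y k" by blast
    show False
    proof (rule sep[OF open_bit[of k True] open_bit[of k False]])
      show "topspace X \<subseteq> {x \<in> topspace X. tt x > 0 \<and> cc x k = True} \<union> {x \<in> topspace X. tt x > 0 \<and> cc x k = False}"
        using pos by auto
      show "{x \<in> topspace X. tt x > 0 \<and> cc x k = True} \<noteq> {}" "{x \<in> topspace X. tt x > 0 \<and> cc x k = False} \<noteq> {}"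
        using k xy pos by (cases "cc x k"; blast)+
    qed auto
  qed
  show "\<exists>y\<in>topspace X. tt y = s \<and> (s = 0 \<or> cc y = cc x)"
    if x: "x \<in> topspace X" and s: "0 \<le> s" "s \<le> tt x" for x s
  proof (rule ccontr)
    assume contr: "\<not> ?thesis"
    then have s0: "s > 0" and sx: "s < tt x" using root s x by force+
    have "\<exists>n. \<forall>y\<in>topspace X. \<not> (\<bar>tt y - s\<bar> \<le> (1/2) ^ n \<and> (s = 0 \<or> (\<forall>k<n. cc y k = cc x k)))"
      using contr s by (intro closed_misses_nbhd) auto
    then obtain n where n: "\<And>y. y \<in> topspace X \<Longrightarrow> \<forall>k<n. cc y k = cc x k \<Longrightarrow> \<bar>tt y - s\<bar> > (1/2) ^ n"
      using s0 by (metis less_irrefl not_le)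
    define U where "U = {y \<in> topspace X. tt y > s} \<inter> {y \<in> topspace X. tt y > 0 \<and> (\<forall>k<n. cc y k = cc x k)}"
    define V where "V = {y \<in> topspace X. tt y < s} \<union> {y \<in> topspace X. tt y > 0 \<and> \<not> (\<forall>k<n. cc y k = cc x k)}"
    show False
    proof (rule sep[of U V])
      show "openin X U" unfolding U_def using open_gt open_agree by (simp add: openin_Int)
      show "openin X V" unfolding V_def using open_lt open_disagree[of n "cc x"] by (simp add: openin_Un)
      have "tt y \<noteq> s" if "y \<in> topspace X" "\<forall>k<n. cc y k = cc x k" for y
      proof
        assume "tt y = s"
        then have "(0::real) > (1/2) ^ n" using n[OF that] by simp
        then show False by (simp add: not_less[symmetric])
      qed
      then show "topspace X \<subseteq> U \<union> V" using s0 by (force simp: U_def V_def)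
      show "U \<inter> V = {}" by (auto simp: U_def V_def)
      show "U \<noteq> {}" using x sx s0 by (auto simp: U_def)
      show "V \<noteq> {}" using root s0 by (auto simp: V_def)
    qed
  qed
qed

text \<open>Continuity pulls back the open conditions and injectivity keeps the coordinates
  faithful, so a compact space embedded in the Cantor fan inherits its coordinates.\<close>

lemma fan_coordinates_pullback:
  assumes Z: "compact_space Z" and e: "continuous_map Z X e" "inj_on e (topspace Z)"
  shows "fan_coordinates Z (cc \<circ> e) (tt \<circ> e)"
proof
  have eX: "e z \<in> topspace X" if "z \<in> topspace Z" for z
    using e(1) that by (auto simp: continuous_map_def)
  have pre: "openin Z {z \<in> topspace Z. Q (e z)}" if "openin X {x \<in> topspace X. Q x}" for Q
  proof -
    have "{z \<in> topspace Z. Q (e z)} = {z \<in> topspace Z. e z \<in> {x \<in> topspace X. Q x}}"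
      using eX by auto
    then show ?thesis using openin_continuous_map_preimage[OF e(1) that] by simp
  qed
  show "0 \<le> (tt \<circ> e) x \<and> (tt \<circ> e) x \<le> 1" if "x \<in> topspace Z" for x
    using tt_range eX that by simp
  show "x = y" if "x \<in> topspace Z" "y \<in> topspace Z" "(tt \<circ> e) x = (tt \<circ> e) y"
    "(tt \<circ> e) x = 0 \<or> (cc \<circ> e) x = (cc \<circ> e) y" for x y
    using that coordinates_inj[of "e x" "e y"] eX e(2) by (auto simp: inj_on_def)
  show "openin Z {x \<in> topspace Z. (tt \<circ> e) x < u}" for u
    using pre[OF open_lt[of u]] by simp
  show "openin Z {x \<in> topspace Z. (tt \<circ> e) x > u}" for u
    using pre[OF open_gt[of u]] by simp
  show "openin Z {x \<in> topspace Z. (tt \<circ> e) x > 0 \<and> (cc \<circ> e) x k = b}" for k b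
    using pre[OF open_bit[of k b]] by simp
qed (rule Z)

end

section \<open>The Cantor fan\<close>

definition fan_class :: "(nat \<Rightarrow> bool) \<times> real \<Rightarrow> ((nat \<Rightarrow> bool) \<times> real) set" where
  "fan_class z = (if snd z = 0 then topspace cantor_space \<times> {0} else {z})"

text \<open>Classes of positive height are singletons, so the choice is forced there; on the
  collapsed class it yields an arbitrary address.\<close>

definition fan_spoke :: "((nat \<Rightarrow> bool) \<times> real) set \<Rightarrow> nat \<Rightarrow> bool" where
  "fan_spoke S = fst (SOME z. z \<in> S)"

definition fan_height :: "((nat \<Rightarrow> bool) \<times> real) set \<Rightarrow> real" where
  "fan_height S = snd (SOME z. z \<in> S)"

lemma topspace_cantor_space [simp]: "topspace cantor_space = UNIV"
  by (simp add: cantor_space_def)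

lemma fan_height_class [simp]: "fan_height (fan_class z) = snd z"
proof (cases "snd z = 0")
  case True
  then have "(undefined, 0) \<in> fan_class z" by (simp add: fan_class_def)
  then have "(SOME y. y \<in> fan_class z) \<in> fan_class z" by (rule someI)
  then show ?thesis using True by (auto simp: fan_height_def fan_class_def)
qed (simp add: fan_height_def fan_class_def)

lemma fan_spoke_class: "snd z \<noteq> 0 \<Longrightarrow> fan_spoke (fan_class z) = fst z"
  by (simp add: fan_spoke_def fan_class_def)

lemma fan_class_eqI: "snd z = snd w \<Longrightarrow> snd z = 0 \<or> fst z = fst w \<Longrightarrow> fan_class z = fan_class w"
  by (auto simp: fan_class_def prod_eq_iff)

lemma cantor_fan_eq:
  "cantor_fan = quotient_topology (prod_topology cantor_space (top_of_set {0..1})) fan_class"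
  unfolding cantor_fan_def fan_class_def ..

lemma topspace_cantor_fan: "topspace cantor_fan = fan_class ` (UNIV \<times> {0..1})"
  by (simp add: cantor_fan_eq)

lemma compact_cantor_fan: "compact_space cantor_fan"
proof -
  have "compact_space cantor_space"
    by (simp add: cantor_space_def compact_space_product_topology compact_space_discrete_topology)
  then have "compact_space (prod_topology cantor_space (top_of_set {0..1::real}))"
    by (simp add: compact_space_prod_topology compact_space_subtopology)
  then show ?thesis
    using image_compactin[OF _ quotient_imp_continuous_map[OF quotient_map_quotient_topology]]
    by (simp add: compact_space_def cantor_fan_eq)
qed

lemma openin_cantor_fan:
  assumes "openin (prod_topology cantor_space (top_of_set {0..1})) {z \<in> UNIV \<times> {0..1}. Q (fan_class z)}"
  shows "openin cantor_fan {S \<in> topspace cantor_fan. Q S}"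
proof -
  have "{z \<in> UNIV \<times> {0..1}. Q (fan_class z)} =
      {z \<in> UNIV \<times> {0..1}. fan_class z \<in> {S \<in> topspace cantor_fan. Q S}}"
    by (auto simp: topspace_cantor_fan)
  then show ?thesis
    using assms unfolding cantor_fan_eq openin_quotient_topology by auto
qed

lemma fan_coordinates_cantor_fan: "fan_coordinates cantor_fan fan_spoke fan_height"
proof
  let ?Z = "prod_topology cantor_space (top_of_set {0..1::real})"
  have top: "topspace ?Z = UNIV \<times> {0..1}" by simp
  have snd: "continuous_map ?Z euclideanreal snd"
    using continuous_map_snd continuous_map_into_fulltopology by blast
  have lt: "openin ?Z {z \<in> UNIV \<times> {0..1}. snd z < u}" and gt: "openin ?Z {z \<in> UNIV \<times> {0..1}. snd z > u}" for u
    using snd unfolding continuous_map_upper_lower_semicontinuous_lt top by blast+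
  have bit: "openin ?Z {z \<in> UNIV \<times> {0..1}. fst z k = b}" for k b
  proof -
    have "continuous_map cantor_space (discrete_topology UNIV) (\<lambda>c. c k)"
      unfolding cantor_space_def by (intro continuous_map_product_projection) simp
    then have "continuous_map ?Z (discrete_topology UNIV) (\<lambda>z. fst z k)"
      using continuous_map_compose[OF continuous_map_fst] by (auto simp: o_def)
    from openin_continuous_map_preimage[OF this, of "{b}"] show ?thesis by simp
  qed
  show "compact_space cantor_fan" by (rule compact_cantor_fan)
  show "0 \<le> fan_height S \<and> fan_height S \<le> 1" if "S \<in> topspace cantor_fan" for S
    using that by (auto simp: topspace_cantor_fan)
  show "S = T" if ST: "S \<in> topspace cantor_fan" "T \<in> topspace cantor_fan" "fan_height S = fan_height T"
    "fan_height S = 0 \<or> fan_spoke S = fan_spoke T" for S T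
  proof -
    obtain z w where "S = fan_class z" "T = fan_class w"
      using ST(1,2) by (auto simp: topspace_cantor_fan)
    then show ?thesis
      using ST(3,4) fan_class_eqI[of z w] fan_spoke_class[of z] fan_spoke_class[of w]
      by (cases "snd z = 0") simp_all
  qed
  show "openin cantor_fan {S \<in> topspace cantor_fan. fan_height S < u}" for u
    using lt by (intro openin_cantor_fan) simp
  show "openin cantor_fan {S \<in> topspace cantor_fan. fan_height S > u}" for u
    using gt by (intro openin_cantor_fan) simp
  show "openin cantor_fan {S \<in> topspace cantor_fan. fan_height S > 0 \<and> fan_spoke S k = b}" for k b
  proof (rule openin_cantor_fan)
    \<comment> \<open>Positive height excludes the collapsed class, so the bit can be read from the
      representative.\<close>
    have "{z \<in> UNIV \<times> {0..1}. fan_height (fan_class z) > 0 \<and> fan_spoke (fan_class z) k = b} =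
        {z \<in> UNIV \<times> {0..1}. snd z > 0} \<inter> {z \<in> UNIV \<times> {0..1}. fst z k = b}"
      by (auto simp: fan_spoke_class)
    then show "openin ?Z {z \<in> UNIV \<times> {0..1}. fan_height (fan_class z) > 0 \<and> fan_spoke (fan_class z) k = b}"
      using openin_Int[OF gt[of 0] bit[of k b]] by simp
  qed
qed

lemma comb_cantor_fan: "comb cantor_fan fan_spoke fan_height"
proof -
  interpret fan_coordinates cantor_fan fan_spoke fan_height by (rule fan_coordinates_cantor_fan)
  show ?thesis
  proof
    show "\<exists>T\<in>topspace cantor_fan. fan_height T = s \<and> (s = 0 \<or> fan_spoke T = fan_spoke S)"
      if S: "S \<in> topspace cantor_fan" "0 \<le> s" "s \<le> fan_height S" for S s
    proof -
      obtain z where z: "S = fan_class z" "z \<in> UNIV \<times> {0..1}"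
        using S(1) by (auto simp: topspace_cantor_fan)
      then have "fan_class (fst z, s) \<in> topspace cantor_fan"
        using S by (auto simp: topspace_cantor_fan)
      then show ?thesis
        using z S by (intro bexI[of _ "fan_class (fst z, s)"]) (auto simp: fan_spoke_class)
    qed
    let ?x = "fan_class (\<lambda>_. False, 1)" and ?y = "fan_class (\<lambda>_. True, 1)" and ?z = "fan_class (\<lambda>n. n = 0, 1)"
    have "(\<lambda>_. False) \<noteq> (\<lambda>n::nat. n = 0)" "(\<lambda>_. True) \<noteq> (\<lambda>n::nat. n = 0)"
      by (metis, metis zero_neq_one)
    then show "\<exists>x y z. {x, y, z} \<subseteq> topspace cantor_fan \<and> fan_height x > 0 \<and> fan_height y > 0 \<and> fan_height z > 0 \<and>
        fan_spoke x \<noteq> fan_spoke y \<and> fan_spoke x \<noteq> fan_spoke z \<and> fan_spoke y \<noteq> fan_spoke z"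
      by (intro exI[of _ ?x] exI[of _ ?y] exI[of _ ?z]) (auto simp: topspace_cantor_fan fan_spoke_class fun_eq_iff)
  qed
qed

theorem corollary5p33:
  shows "(\<exists>(G :: nat \<Rightarrow> nat graph) R.
            graph_sequence X_morphism G R \<and> cantor_fan homeomorphic_space sequence_spectrum G R) \<and>
         (\<forall>X :: 'a topology. smooth_fan X \<longrightarrow>
            (\<exists>(G :: nat \<Rightarrow> nat graph) R.
               graph_sequence L_morphism G R \<and> X homeomorphic_space sequence_spectrum G R))"
proof (intro conjI allI impI)
  interpret comb cantor_fan fan_spoke fan_height by (rule comb_cantor_fan)
  have "\<exists>S\<in>topspace cantor_fan. fan_spoke S = c \<and> fan_height S = 1" for c
    by (intro bexI[of _ "fan_class (c, 1)"]) (auto simp: fan_spoke_class topspace_cantor_fan)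
  then show "\<exists>(G :: nat \<Rightarrow> nat graph) R.
      graph_sequence X_morphism G R \<and> cantor_fan homeomorphic_space sequence_spectrum G R"
    using graph_sequence_X homeomorphic_spectrum by blast
next
  fix X :: "'a topology"
  assume "smooth_fan X"
  then obtain e p where X: "compact_space X" "connected_space X" "ramification_point X p"
    and e: "embedding_map X cantor_fan e"
    by (auto simp: smooth_fan_def topological_fan_def continuum_def)
  have "fan_coordinates X (fan_spoke \<circ> e) (fan_height \<circ> e)"
    using fan_coordinates.fan_coordinates_pullback[OF fan_coordinates_cantor_fan X(1)]
      embedding_map_imp_continuous_map[OF e] embedding_imp_injective_map[OF e] by blast
  then interpret comb X "fan_spoke \<circ> e" "fan_height \<circ> e"
    using X(2,3) by (rule fan_coordinates.comb_if_connected)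
  show "\<exists>(G :: nat \<Rightarrow> nat graph) R. graph_sequence L_morphism G R \<and> X homeomorphic_space sequence_spectrum G R"
    using graph_sequence_L homeomorphic_spectrum by blast
qed

end
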